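(* Let $d\ge 1$, let $\alpha\in[0,1)$ and let $\mu$ be a non-singular probability measure on $\mathbb{R}^d$. For every $r>0$ there is a constant $C=C(r,\mu,\alpha)>0$ such that every generalized step-reinforced random walk $S=(S_n)_{n\ge 0}$ on $\mathbb{R}^d$ with reinforcement parameter $\alpha$ and step distribution $\mu$ (with any transformations $(T_n)_{n\ge 2}$) satisfies $$\sup_{x\in\mathbb{R}^d}\mathbb{P}(S_n\in B(x,r))\le C n^{-d/2},\qquad n\ge 1,$$ where $B(x,r)$ is the open Euclidean ball of radius $r$ centered at $x$. In particular, if $d\ge 3$, then $S$ is transient.
   Context: Generalized step-reinforced random walk (SRRW) on $\mathbb{R}^d$. The group is $(\mathbb{R}^d,+)$ with its Borel $\sigma$-algebra, and $\mu$ is a probability measure on $\mathbb{R}^d$. Let $(g_n)_{n\ge1}$ be i.i.d. with law $\mu$, let $(\xi_n)_{n\ge2}$ be i.i.d. Bernoulli with parameter $\alpha\in[0,1]$, let $(u_n)_{n\ge2}$ be independent with $u_n$ uniform on $\{1,\ldots,n-1\}$, and let $(T_n)_{n\ge2}$ be random measurable transformations of $\mathbb{R}^d$ with $(\omega,g)\mapsto T_n(\omega,g)$ jointly measurable. The four sequences $(g_n),(\xi_n),(u_n),(T_n)$ are mutually independent; no independence among the $T_n$ is required. Set $S_0=0$, $X_1=g_1$, and for $n\ge2$ set $X_n=g_n$ if $\xi_n=0$ and $X_n=T_n(X_{u_n})$ if $\xi_n=1$. Put $S_n=X_1+\cdots+X_n$ for $n\ge1$. Then $S$ is the generalized SRRW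 with reinforcement parameter $\alpha$, step distribution $\mu$ and transformations $(T_n)$. $\mu$ is non-singular if it is not supported on any proper affine hyperplane, equivalently $\operatorname{span}(\operatorname{supp}\mu-\operatorname{supp}\mu)=\mathbb{R}^d$. $S$ is transient if $\|S_n\|\to\infty$ almost surely, where $\|\cdot\|$ is the Euclidean norm. *)

theory Defs
  imports "HOL-Probability.Probability"
begin

definition nonsingular :: "'a::euclidean_space measure \<Rightarrow> bool" where
  "nonsingular \<mu> \<longleftrightarrow> \<not> (\<exists>a b. a \<noteq> 0 \<and> (AE x in \<mu>. x \<in> {x. a \<bullet> x = b}))"

definition process_sigma ::
  "'w measure \<Rightarrow> nat set \<Rightarrow> (nat \<Rightarrow> 'b measure) \<Rightarrow> (nat \<Rightarrow> 'w \<Rightarrow> 'b) \<Rightarrow> 'w set set" where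
  "process_sigma M I N Y =
     sigma_sets (space M) (\<Union>n\<in>I. {Y n -` B \<inter> space M | B. B \<in> sets (N n)})"

(* The value True of \<xi> n stands for \<xi>_n = 1. The guard u n \<omega> < n only serves
   termination: it holds on the whole sample space of a generalized_srrw. *)
fun srrw_step ::
  "(nat \<Rightarrow> 'w \<Rightarrow> 'a) \<Rightarrow> (nat \<Rightarrow> 'w \<Rightarrow> bool) \<Rightarrow> (nat \<Rightarrow> 'w \<Rightarrow> nat) \<Rightarrow>
   (nat \<Rightarrow> 'w \<Rightarrow> 'a \<Rightarrow> 'a) \<Rightarrow> nat \<Rightarrow> 'w \<Rightarrow> 'a" where
  "srrw_step g \<xi> u T n \<omega> =
     (if 2 \<le> n \<and> \<xi> n \<omega> \<and> u n \<omega> < n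
      then T n \<omega> (srrw_step g \<xi> u T (u n \<omega>) \<omega>)
      else g n \<omega>)"

declare srrw_step.simps [simp del]

definition srrw ::
  "(nat \<Rightarrow> 'w \<Rightarrow> 'a::comm_monoid_add) \<Rightarrow> (nat \<Rightarrow> 'w \<Rightarrow> bool) \<Rightarrow> (nat \<Rightarrow> 'w \<Rightarrow> nat) \<Rightarrow>
   (nat \<Rightarrow> 'w \<Rightarrow> 'a \<Rightarrow> 'a) \<Rightarrow> nat \<Rightarrow> 'w \<Rightarrow> 'a" where
  "srrw g \<xi> u T n \<omega> = (\<Sum>k=1..n. srrw_step g \<xi> u T k \<omega>)"

(* The sub-sigma-algebra F carries the randomness of the whole sequence T: every T_n is
   jointly measurable with respect to F (x) borel, and F is what is independent of the
   other three sequences. Independence of the evaluations T_n(., x) alone would not do: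
   on [0,1], the map T(\<omega>, x) = 1 if x = \<omega>, 0 otherwise, is jointly measurable and all its
   evaluations are almost surely constant, although T determines \<omega>. *)
locale generalized_srrw = prob_space M
  for M :: "'w measure" +
  fixes \<mu> :: "'a::euclidean_space measure"
    and \<alpha> :: real
    and F :: "'w measure"
    and g :: "nat \<Rightarrow> 'w \<Rightarrow> 'a"
    and \<xi> :: "nat \<Rightarrow> 'w \<Rightarrow> bool"
    and u :: "nat \<Rightarrow> 'w \<Rightarrow> nat"
    and T :: "nat \<Rightarrow> 'w \<Rightarrow> 'a \<Rightarrow> 'a"
  assumes alpha: "0 \<le> \<alpha>" "\<alpha> \<le> 1"
    and g_indep: "indep_vars (\<lambda>_. borel) g {1..}"
    and g_distr: "\<And>n. 1 \<le> n \<Longrightarrow> distr M borel (g n) = \<mu>"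
    and xi_indep: "indep_vars (\<lambda>_. count_space UNIV) \<xi> {2..}"
    and xi_distr: "\<And>n. 2 \<le> n \<Longrightarrow>
          distr M (count_space UNIV) (\<xi> n) = measure_pmf (bernoulli_pmf \<alpha>)"
    and u_indep: "indep_vars (\<lambda>n. count_space {1..n-1}) u {2..}"
    and u_distr: "\<And>n. 2 \<le> n \<Longrightarrow>
          distr M (count_space {1..n-1}) (u n) = uniform_count_measure {1..n-1}"
    and F_subalgebra: "subalgebra M F"
    and T_measurable: "\<And>n. 2 \<le> n \<Longrightarrow> (\<lambda>(\<omega>, x). T n \<omega> x) \<in> F \<Otimes>\<^sub>M borel \<rightarrow>\<^sub>M borel"
    and sequences_indep: "indep_sets
          (\<lambda>i::nat. [process_sigma M {1..} (\<lambda>_. borel) g,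
                process_sigma M {2..} (\<lambda>_. count_space UNIV) \<xi>,
                process_sigma M {2..} (\<lambda>n. count_space {1..n-1}) u,
                sets F] ! i) {..<4}"
begin

lemma srrw_step_1: "srrw_step g \<xi> u T 1 \<omega> = g 1 \<omega>"
  by (subst srrw_step.simps) simp

lemma srrw_step_rec:
  assumes "2 \<le> n" "\<omega> \<in> space M"
  shows "srrw_step g \<xi> u T n \<omega> =
    (if \<xi> n \<omega> then T n \<omega> (srrw_step g \<xi> u T (u n \<omega>) \<omega>) else g n \<omega>)"
proof -
  have "u n \<in> M \<rightarrow>\<^sub>M count_space {1..n-1}"
    using u_indep assms(1) by (auto simp: indep_vars_def)
  from measurable_space[OF this assms(2)] have "u n \<omega> < n"
    using assms(1) by auto
  then show ?thesis
    using assms(1) by (subst srrw_step.simps) simp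
qed

end

(* The bound for all walks whose sample space is a subset of the type 'w. *)
definition srrw_concentration ::
  "'w itself \<Rightarrow> 'a::euclidean_space measure \<Rightarrow> real \<Rightarrow> real \<Rightarrow> real \<Rightarrow> bool" where
  "srrw_concentration _ \<mu> \<alpha> r C \<longleftrightarrow>
     (\<forall>(M :: 'w measure) F g \<xi> u T. generalized_srrw M \<mu> \<alpha> F g \<xi> u T \<longrightarrow>
        (\<forall>n\<ge>1. (SUP x. measure M {\<omega> \<in> space M. srrw g \<xi> u T n \<omega> \<in> ball x r})
                 \<le> C * real n powr (- (real DIM('a) / 2))))"

definition transient :: "'w measure \<Rightarrow> (nat \<Rightarrow> 'w \<Rightarrow> 'a::euclidean_space) \<Rightarrow> bool" where
  "transient M S \<longleftrightarrow> (AE \<omega> in M. filterlim (\<lambda>n. norm (S n \<omega>)) at_top sequentially)"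

(* HOL cannot place a quantifier over sample space types inside a formula. To express that
   one constant serves all of them, it is chosen for the following type, which is large
   enough to carry g, \<xi> and u, and is then claimed to work for every type 'w. *)
type_synonym 'a canonical_space = "(nat \<Rightarrow> 'a) \<times> (nat \<Rightarrow> bool) \<times> (nat \<Rightarrow> nat)"

end

theory Submission
  imports Defs
begin

text \<open>
Freeze the transformations, the Bernoulli variables and the uniform variables. What remains is a
deterministic function of the i.i.d. steps. A fresh step that is never copied enters this function as a
separate summand; the rest is a function of the other steps, whatever the transformations do with them.
So, if \<open>L\<close> is the number of these isolated steps up to time \<open>n\<close>, the walk is a sum of \<open>L\<close> independent
variables with law \<open>\<mu>\<close> and an independent remainder, and the modulus of its characteristic function is
at most that of \<open>\<mu>\<close> to the power \<open>L\<close> (\<open>chf_canonical_walk_le\<close>). For non-singular \<open>\<mu>\<close> the latter is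
below a Gaussian near the origin (\<open>chf_gaussian_decay\<close>), and an inequality of Esseen's type turns this
into a bound \<open>K L powr (- d / 2)\<close> for the probability of any ball (\<open>small_ball_le_gaussian\<close>,
\<open>canonical_walk_ball_le\<close>).

It remains to see that \<open>L\<close> is of order \<open>n\<close> up to an exponentially small probability. Consider only the
times in a window \<open>{m<..n}\<close> whose length is a small multiple of \<open>n\<close>. A fresh time there can only be copied
by a time of the window that chooses a value beyond \<open>m\<close> (\<open>card_isolated_ge\<close>). About \<open>(1 - \<alpha>) (n - m)\<close>
times of the window are fresh, and at most about \<open>(n - m)\<^sup>2 / n\<close> choose a value beyond \<open>m\<close>; Hoeffding's
inequality controls both counts. As \<open>\<alpha> < 1\<close>, the first count wins for a short window.

The constants transfer between sample spaces because the law of a walk is a mixture, over the outcomes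
of its transformations, of laws of walks with fixed transformations that are driven by the product measure
on the canonical space (\<open>prob_srrw_le\<close>). Each walk with fixed transformations is itself a generalized walk on
the canonical space (\<open>generalized_srrw_canonical\<close>), so a constant for that space covers all of them and hence
all mixtures.

In dimension at least three, \<open>n powr (- d / 2)\<close> is summable, and transience follows from the lemma of Borel
and Cantelli.
\<close>

section \<open>Characteristic functions and small balls\<close>

definition chf :: "'a::euclidean_space measure \<Rightarrow> 'a \<Rightarrow> complex" where
  "chf \<nu> t = (\<integral>x. iexp (t \<bullet> x) \<partial>\<nu>)"

lemma one_minus_cos_eq: "1 - cos (y::real) = 2 * (sin (y / 2))\<^sup>2"
  using cos_double_sin[of "y / 2"] by simp

lemma cos_ge_half:
  fixes y :: real
  assumes "\<bar>y\<bar> \<le> 1"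
  shows "1 / 2 \<le> cos y"
proof -
  have "(sin (y / 2))\<^sup>2 \<le> (1 / 2)\<^sup>2"
    using abs_sin_x_le_abs_x[of "y / 2"] assms
    by (intro power2_le_iff_abs_le[THEN iffD2]) auto
  then show ?thesis
    using one_minus_cos_eq[of y] by (simp add: power2_eq_square)
qed

lemma nn_integral_gaussian:
  fixes c m :: real
  assumes "c > 0"
  shows "(\<integral>\<^sup>+y. ennreal (exp (- c * (m - y)\<^sup>2)) \<partial>lborel) = ennreal (sqrt (pi / c))"
proof -
  define \<sigma> where "\<sigma> = sqrt (1 / (2 * c))"
  have \<sigma>: "\<sigma> > 0" "\<sigma>\<^sup>2 = 1 / (2 * c)" using assms by (auto simp: \<sigma>_def)
  have e: "exp (- c * (m - y)\<^sup>2) = sqrt (pi / c) * normal_density m \<sigma> y" for y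
  proof -
    have "pi / c = 2 * pi * \<sigma>\<^sup>2" "c = 1 / (2 * \<sigma>\<^sup>2)"
      using assms by (simp_all add: \<sigma>(2))
    then show ?thesis
      using \<sigma>(1) by (simp add: normal_density_def power2_commute[of m y] mult_ac)
  qed
  have "(\<integral>\<^sup>+y. ennreal (exp (- c * (m - y)\<^sup>2)) \<partial>lborel)
      = (\<integral>\<^sup>+y. ennreal (sqrt (pi / c)) * ennreal (normal_density m \<sigma> y) \<partial>lborel)"
    using assms by (simp only: e ennreal_mult'' normal_density_nonneg)
  also have "\<dots> = ennreal (sqrt (pi / c)) * (\<integral>\<^sup>+y. ennreal (normal_density m \<sigma> y) \<partial>lborel)"
    by (rule nn_integral_cmult) auto
  also have "(\<integral>\<^sup>+y. ennreal (normal_density m \<sigma> y) \<partial>lborel) = 1"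
    using \<sigma> by (subst nn_integral_eq_integral) auto
  finally show ?thesis by simp
qed

lemma nn_integral_gaussian_euclidean:
  fixes m :: "'a::euclidean_space"
  assumes "c > 0"
  shows "(\<integral>\<^sup>+y. ennreal (exp (- c * (norm (m - y))\<^sup>2)) \<partial>lborel) = ennreal (sqrt (pi / c) ^ DIM('a))"
proof -
  have "exp (- c * (norm (m - y))\<^sup>2) = (\<Prod>b\<in>Basis. exp (- c * (m \<bullet> b - y \<bullet> b)\<^sup>2))" for y
    unfolding power2_norm_eq_inner euclidean_inner[of "m - y" "m - y"]
    by (simp add: exp_sum[symmetric] sum_distrib_left inner_diff_left power2_eq_square)
  then have "(\<integral>\<^sup>+y. ennreal (exp (- c * (norm (m - y))\<^sup>2)) \<partial>lborel)
     = (\<integral>\<^sup>+y. (\<Prod>b\<in>Basis. ennreal (exp (- c * (m \<bullet> b - y \<bullet> b)\<^sup>2))) \<partial>lborel)"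
    by (simp add: prod_ennreal)
  also have "\<dots> = (\<Prod>b\<in>(Basis::'a set). \<integral>\<^sup>+y. ennreal (exp (- c * (m \<bullet> b - y)\<^sup>2)) \<partial>lborel)"
    by (rule nn_integral_lborel_prod) auto
  also have "\<dots> = ennreal (sqrt (pi / c)) ^ DIM('a)"
    by (simp only: nn_integral_gaussian[OF assms] prod_constant)
  finally show ?thesis
    using assms by (simp add: ennreal_power)
qed

text \<open>An inequality of Esseen's type. Let \<open>s, t\<close> be independent and uniform on the ball of radius
\<open>\<delta>\<close>. For a point \<open>y\<close> of norm below \<open>r\<close> every \<open>s \<bullet> y\<close> is at most \<open>1\<close> in absolute value, so that
\<open>E cos (s \<bullet> y) \<ge> 1/2\<close> and \<open>\<bar>E exp (i s \<bullet> y)\<bar>\<^sup>2\<close> dominates a quarter of the indicator of the ball.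
Written as the average of \<open>exp (i (s - t) \<bullet> y)\<close>, this square integrates against the law to an average of
its characteristic function over the frequencies \<open>s - t\<close>, which all have norm at most \<open>2\<delta>\<close>.
Only small frequencies enter, which is essential: the characteristic function of a lattice law does
not decay at infinity.\<close>
lemma small_ball_le_gaussian:
  fixes \<nu> :: "'a::euclidean_space measure"
  assumes \<nu>: "prob_space \<nu>" and S[measurable_cong]: "sets \<nu> = sets borel"
    and pos: "\<delta> > 0" "c > 0" and r: "\<delta> * r \<le> 1"
    and decay: "\<And>t. norm t \<le> 2 * \<delta> \<Longrightarrow> norm (chf \<nu> t) \<le> exp (- c * (norm t)\<^sup>2)"
  shows "measure \<nu> (ball x r) \<le> 4 / measure lborel (ball (0::'a) \<delta>) * sqrt (pi / c) ^ DIM('a)"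
proof -
  define v where "v = measure lborel (ball (0::'a) \<delta>)"
  define \<kappa> where "\<kappa> = uniform_measure lborel (ball (0::'a) \<delta>)"
  have fin: "emeasure lborel (ball (0::'a) \<delta>) < \<infinity>"
    using emeasure_bounded_finite[OF bounded_ball] by simp
  have v: "emeasure lborel (ball (0::'a) \<delta>) = ennreal v" "v > 0"
    using fin pos by (auto simp: v_def emeasure_eq_ennreal_measure)
  have [measurable_cong]: "sets \<kappa> = sets borel" by (simp add: \<kappa>_def)
  interpret \<nu>: prob_space \<nu> by fact
  interpret \<kappa>: prob_space \<kappa>
    unfolding \<kappa>_def using fin v by (intro prob_space_uniform_measure) auto
  interpret Q: pair_prob_space \<kappa> \<kappa> ..
  interpret QN: pair_prob_space "\<kappa> \<Otimes>\<^sub>M \<kappa>" \<nu> ..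
  let ?I = "\<lambda>y. \<integral>s. iexp (s \<bullet> y) \<partial>\<kappa>"
  have int: "integrable \<kappa> (\<lambda>s. iexp (s \<bullet> y))" for y
    by (intro \<kappa>.integrable_const_bound[of _ 1]) auto
  have sq: "(\<integral>p. iexp ((fst p - snd p) \<bullet> y) \<partial>(\<kappa> \<Otimes>\<^sub>M \<kappa>)) = of_real ((norm (?I y))\<^sup>2)" for y
  proof -
    have "(\<integral>p. iexp ((fst p - snd p) \<bullet> y) \<partial>(\<kappa> \<Otimes>\<^sub>M \<kappa>)) = (\<integral>s. \<integral>t. iexp ((s - t) \<bullet> y) \<partial>\<kappa> \<partial>\<kappa>)"
      by (subst Q.integral_fst'[symmetric])
         (auto intro!: Q.integrable_const_bound[of _ 1])
    also have "\<dots> = (\<integral>s. \<integral>t. iexp (s \<bullet> y) * cnj (iexp (t \<bullet> y)) \<partial>\<kappa> \<partial>\<kappa>)"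
      by (simp add: inner_diff_left exp_cnj exp_add[symmetric] algebra_simps)
    also have "\<dots> = ?I y * cnj (?I y)"
      using int by simp
    finally show ?thesis
      by (simp only: complex_norm_square)
  qed
  have half: "1 / 4 \<le> (norm (?I y))\<^sup>2" if y: "norm y < r" for y
  proof -
    have "1 / 2 \<le> (\<integral>s. cos (s \<bullet> y) \<partial>\<kappa>)"
    proof (rule \<kappa>.integral_ge_const)
      show "integrable \<kappa> (\<lambda>s. cos (s \<bullet> y))"
        by (intro \<kappa>.integrable_const_bound[of _ 1]) auto
      have "1 / 2 \<le> cos (s \<bullet> y)" if "s \<in> ball 0 \<delta>" for s
      proof (rule cos_ge_half)
        have "\<bar>s \<bullet> y\<bar> \<le> norm s * norm y" by (rule Cauchy_Schwarz_ineq2)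
        also have "\<dots> \<le> \<delta> * r" using that y pos by (intro mult_mono) auto
        finally show "\<bar>s \<bullet> y\<bar> \<le> 1" using r by simp
      qed
      then show "AE s in \<kappa>. 1 / 2 \<le> cos (s \<bullet> y)"
        unfolding \<kappa>_def by (intro AE_uniform_measureI) auto
    qed
    also have "\<dots> = Re (?I y)"
      using integral_Re[OF int[of y]] by (simp add: Re_exp)
    also have "\<dots> \<le> norm (?I y)" by (rule complex_Re_le_cmod)
    finally have "(1 / 2)\<^sup>2 \<le> (norm (?I y))\<^sup>2" by (intro power_mono) auto
    then show ?thesis by (simp add: power2_eq_square)
  qed
  have [measurable]: "(\<lambda>y. norm (?I (y - x))) \<in> borel_measurable \<nu>" by measurable
  have le1: "norm (?I y) \<le> 1" for y
    by (rule order_trans[OF integral_norm_bound]) (simp add: \<kappa>.prob_space)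
  have "measure \<nu> (ball x r) / 4 = (\<integral>y. indicator (ball x r) y / 4 \<partial>\<nu>)"
    by simp
  also have "\<dots> \<le> (\<integral>y. (norm (?I (y - x)))\<^sup>2 \<partial>\<nu>)"
  proof (rule integral_mono)
    show "integrable \<nu> (\<lambda>y. (norm (?I (y - x)))\<^sup>2)"
      using le1 by (intro \<nu>.integrable_const_bound[of _ 1]) (auto simp: power_le_one)
    show "indicator (ball x r) y / 4 \<le> (norm (?I (y - x)))\<^sup>2" for y
      using half[of "y - x"] by (auto simp: indicator_def dist_norm norm_minus_commute)
    show "integrable \<nu> (\<lambda>y. indicator (ball x r) y / 4 :: real)"
      by (intro \<nu>.integrable_const_bound[of _ 1]) (auto simp: indicator_def)
  qed
  also have "\<dots> = norm (complex_of_real (\<integral>y. (norm (?I (y - x)))\<^sup>2 \<partial>\<nu>))"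
    by simp
  also have "complex_of_real (\<integral>y. (norm (?I (y - x)))\<^sup>2 \<partial>\<nu>)
      = (\<integral>y. \<integral>p. iexp ((fst p - snd p) \<bullet> (y - x)) \<partial>(\<kappa> \<Otimes>\<^sub>M \<kappa>) \<partial>\<nu>)"
    by (simp only: sq integral_complex_of_real)
  also have "\<dots> = (\<integral>p. \<integral>y. iexp ((fst p - snd p) \<bullet> (y - x)) \<partial>\<nu> \<partial>(\<kappa> \<Otimes>\<^sub>M \<kappa>))"
    by (rule QN.Fubini_integral) (auto intro!: QN.integrable_const_bound[of _ 1])
  also have "\<dots> = (\<integral>p. iexp (- ((fst p - snd p) \<bullet> x)) * chf \<nu> (fst p - snd p) \<partial>(\<kappa> \<Otimes>\<^sub>M \<kappa>))"
  proof -
    have "iexp (d \<bullet> (y - x)) = iexp (- (d \<bullet> x)) * iexp (d \<bullet> y)" for d y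
      by (simp add: inner_diff_right exp_add[symmetric] algebra_simps)
    then show ?thesis
      unfolding chf_def by (simp only: integral_mult_right_zero)
  qed
  also have "norm \<dots> \<le> (\<integral>p. norm (chf \<nu> (fst p - snd p)) \<partial>(\<kappa> \<Otimes>\<^sub>M \<kappa>))"
    by (rule order_trans[OF integral_norm_bound]) (simp add: norm_mult)
  also have "\<dots> \<le> (1 / v) * sqrt (pi / c) ^ DIM('a)"
  proof -
    let ?G = "\<lambda>s t. ennreal (exp (- c * (norm (s - t))\<^sup>2))"
    have [measurable]: "chf \<nu> \<in> borel_measurable borel"
      unfolding chf_def by measurable
    have chf1: "norm (chf \<nu> t) \<le> 1" for t
      unfolding chf_def by (rule order_trans[OF integral_norm_bound]) (simp add: \<nu>.prob_space)
    \<comment> \<open>The Gaussian is integrated over the whole space instead of the ball, uniformly in the centre.\<close>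
    have inner: "(\<integral>\<^sup>+t. ?G s t \<partial>\<kappa>) \<le> ennreal (sqrt (pi / c) ^ DIM('a) / v)" for s
    proof -
      have "(\<integral>\<^sup>+t. ?G s t \<partial>\<kappa>) = (\<integral>\<^sup>+t. ?G s t * indicator (ball 0 \<delta>) t \<partial>lborel) / ennreal v"
        unfolding \<kappa>_def v(1)[symmetric] by (rule nn_integral_uniform_measure) auto
      also have "\<dots> \<le> (\<integral>\<^sup>+t. ?G s t \<partial>lborel) / ennreal v"
        by (intro divide_right_mono_ennreal nn_integral_mono) (auto simp: indicator_def)
      also have "\<dots> = ennreal (sqrt (pi / c) ^ DIM('a) / v)"
        using v(2) pos by (simp only: nn_integral_gaussian_euclidean[OF pos(2)]) (simp add: divide_ennreal)
      finally show ?thesis .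
    qed
    have "ennreal (\<integral>p. norm (chf \<nu> (fst p - snd p)) \<partial>(\<kappa> \<Otimes>\<^sub>M \<kappa>))
        = (\<integral>\<^sup>+p. ennreal (norm (chf \<nu> (fst p - snd p))) \<partial>(\<kappa> \<Otimes>\<^sub>M \<kappa>))"
      using chf1 by (intro nn_integral_eq_integral[symmetric] Q.integrable_const_bound[of _ 1]) auto
    also have "\<dots> = (\<integral>\<^sup>+s. \<integral>\<^sup>+t. ennreal (norm (chf \<nu> (s - t))) \<partial>\<kappa> \<partial>\<kappa>)"
      by (subst \<kappa>.nn_integral_fst[symmetric]) auto
    also have "\<dots> \<le> (\<integral>\<^sup>+s. \<integral>\<^sup>+t. ?G s t \<partial>\<kappa> \<partial>\<kappa>)"
    proof -
      have "norm (chf \<nu> (s - t)) \<le> exp (- c * (norm (s - t))\<^sup>2)" if "s \<in> ball 0 \<delta>" "t \<in> ball 0 \<delta>" for s t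
        using that norm_triangle_ineq4[of s t] by (intro decay) auto
      then have "AE s in \<kappa>. AE t in \<kappa>. ennreal (norm (chf \<nu> (s - t))) \<le> ?G s t"
        unfolding \<kappa>_def by (auto intro!: AE_uniform_measureI ennreal_leI)
      then show ?thesis
        by (intro nn_integral_mono_AE) (auto elim!: eventually_mono intro!: nn_integral_mono_AE)
    qed
    also have "\<dots> \<le> (\<integral>\<^sup>+s. ennreal (sqrt (pi / c) ^ DIM('a) / v) \<partial>\<kappa>)"
      by (intro nn_integral_mono inner)
    also have "\<dots> = ennreal (sqrt (pi / c) ^ DIM('a) / v)"
      by (simp add: \<kappa>.emeasure_space_1)
    finally show ?thesis
      using v(2) pos by (subst (asm) ennreal_le_iff) (auto simp: divide_simps)
  qed
  finally show ?thesis by (simp add: v_def mult_ac)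
qed

text \<open>The mean value theorem gives \<open>sin (y / 2) = (y / 2) cos z\<close> for some \<open>\<bar>z\<bar> \<le> 1\<close>, and this cosine is
at least \<open>1/2\<close>.\<close>
lemma one_minus_cos_ge:
  fixes y :: real
  assumes "\<bar>y\<bar> \<le> 1"
  shows "y\<^sup>2 / 8 \<le> 1 - cos y"
proof -
  have "\<bar>y / 4\<bar> \<le> \<bar>sin (y / 2)\<bar>"
  proof (cases "y = 0")
    case False
    have "\<exists>z. \<bar>z\<bar> \<le> 1 \<and> sin (y / 2) = y / 2 * cos z"
    proof (cases "y > 0")
      case True
      from MVT2[of 0 "y / 2" sin cos] True obtain z where "0 < z" "z < y / 2" "sin (y / 2) - sin 0 = (y / 2 - 0) * cos z"
        by (auto simp: DERIV_sin)
      then show ?thesis using assms by (intro exI[of _ z]) auto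
    next
      case n: False
      from MVT2[of "y / 2" 0 sin cos] n False obtain z where "y / 2 < z" "z < 0" "sin 0 - sin (y / 2) = (0 - y / 2) * cos z"
        by (auto simp: DERIV_sin)
      then show ?thesis using assms by (intro exI[of _ z]) auto
    qed
    then obtain z where z: "\<bar>z\<bar> \<le> 1" "sin (y / 2) = y / 2 * cos z" by blast
    have "\<bar>y / 2\<bar> * (1 / 2) \<le> \<bar>y / 2\<bar> * \<bar>cos z\<bar>"
      using cos_ge_half[OF z(1)] by (intro mult_left_mono) auto
    then show ?thesis using z(2) by (simp add: abs_mult)
  qed simp
  then have "(y / 4)\<^sup>2 \<le> (sin (y / 2))\<^sup>2" by (rule abs_le_square_iff[THEN iffD1])
  then show ?thesis using one_minus_cos_eq[of y] by (simp add: power2_eq_square)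
qed

text \<open>Let \<open>D = X - X'\<close> be the difference of two independent points with law \<open>\<mu>\<close>, so that
\<open>\<bar>chf \<mu> t\<bar>\<^sup>2 = E cos (t \<bullet> D)\<close>. Non-singularity says that \<open>u \<bullet> D\<close> is not almost surely zero for any unit
vector \<open>u\<close>. As \<open>D\<close> need not have a second moment, the quadratic form is damped: the function
\<open>u \<mapsto> E ((u \<bullet> D)\<^sup>2 / (1 + \<bar>D\<bar>\<^sup>2))\<close> is continuous and positive on the compact unit sphere, hence bounded below
by some \<open>c > 0\<close>. Its integrand is at most \<open>1\<close>, so restricting it to \<open>\<bar>D\<bar> \<le> R\<close> with
\<open>P (\<bar>D\<bar> > R) < c / 2\<close> leaves at least \<open>c / 2\<close>. For \<open>\<bar>t\<bar> \<le> 1 / R\<close> the quadratic lower bound of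
\<open>1 - cos\<close> applies on that event.\<close>
lemma chf_gaussian_decay:
  fixes \<mu> :: "'a::euclidean_space measure"
  assumes \<mu>: "prob_space \<mu>" and S[measurable_cong]: "sets \<mu> = sets borel" and ns: "nonsingular \<mu>"
  obtains c \<delta> where "c > 0" "\<delta> > 0" "\<And>t. norm t \<le> \<delta> \<Longrightarrow> norm (chf \<mu> t) \<le> exp (- c * (norm t)\<^sup>2)"
proof -
  interpret \<mu>: prob_space \<mu> by fact
  interpret D: pair_prob_space \<mu> \<mu> ..
  let ?D = "\<mu> \<Otimes>\<^sub>M \<mu>"
  let ?d = "\<lambda>p::'a \<times> 'a. fst p - snd p"
  let ?h = "\<lambda>u p. (u \<bullet> ?d p)\<^sup>2 / (1 + (norm (?d p))\<^sup>2)"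
  have h1: "?h u p \<le> 1" "0 \<le> ?h u p" if "norm u = 1" for u p
  proof -
    have "\<bar>u \<bullet> ?d p\<bar> \<le> norm (?d p)" using Cauchy_Schwarz_ineq2[of u "?d p"] that by simp
    then have "(u \<bullet> ?d p)\<^sup>2 \<le> (norm (?d p))\<^sup>2"
      by (intro power2_le_iff_abs_le[THEN iffD2]) auto
    then have "(u \<bullet> ?d p)\<^sup>2 \<le> 1 + (norm (?d p))\<^sup>2" by simp
    moreover have "0 < 1 + (norm (?d p))\<^sup>2" by (simp add: add_pos_nonneg)
    ultimately show "?h u p \<le> 1" by (simp add: divide_le_eq_1)
  qed auto
  have inth: "integrable ?D (?h u)" if "norm u = 1" for u
    using h1[OF that] by (intro D.integrable_const_bound[of _ 1]) auto
  \<comment> \<open>Dominated convergence; the integrand is bounded by 1 on the unit sphere.\<close>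
  have cont: "continuous_on (sphere 0 1) (\<lambda>u. \<integral>p. ?h u p \<partial>?D)"
    unfolding continuous_on_sequentially
  proof (intro allI ballI impI, elim conjE)
    fix X u assume X: "\<forall>n::nat. X n \<in> sphere (0::'a) 1" "X \<longlonglongrightarrow> u" and u: "u \<in> sphere 0 1"
    have "(\<lambda>n. \<integral>p. ?h (X n) p \<partial>?D) \<longlonglongrightarrow> (\<integral>p. ?h u p \<partial>?D)"
    proof (rule integral_dominated_convergence[where w = "\<lambda>_. 1"])
      show "AE p in ?D. (\<lambda>n. ?h (X n) p) \<longlonglongrightarrow> ?h u p"
        using X(2) by (auto intro!: tendsto_intros add_pos_nonneg simp: add_nonneg_eq_0_iff)
      show "AE p in ?D. norm (?h (X n) p) \<le> 1" for n
        using h1[of "X n"] X(1) by auto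
    qed auto
    then show "((\<lambda>u. \<integral>p. ?h u p \<partial>?D) \<circ> X) \<longlonglongrightarrow> (\<integral>p. ?h u p \<partial>?D)" by (simp add: o_def)
  qed
  have pos: "0 < (\<integral>p. ?h u p \<partial>?D)" if u: "norm u = 1" for u
  proof (rule ccontr)
    assume "\<not> 0 < (\<integral>p. ?h u p \<partial>?D)"
    moreover have "0 \<le> (\<integral>p. ?h u p \<partial>?D)" using h1[OF u] by (intro Bochner_Integration.integral_nonneg) auto
    ultimately have "(\<integral>p. ?h u p \<partial>?D) = 0" by simp
    then have "AE p in ?D. ?h u p = 0"
      using integral_nonneg_eq_0_iff_AE[OF inth[OF u]] h1[OF u] by simp
    then have "AE p in ?D. u \<bullet> snd p = u \<bullet> fst p"
      by (rule eventually_mono) (auto simp: add_nonneg_eq_0_iff inner_diff_right)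
    from D.AE_pair[OF this] have "AE x in \<mu>. AE y in \<mu>. u \<bullet> y = u \<bullet> x" by simp
    then obtain x where x: "AE y in \<mu>. u \<bullet> y = u \<bullet> x"
      using eventually_happens'[OF \<mu>.ae_filter_bot] by blast
    have "u \<noteq> 0" using u by auto
    with x show False using ns unfolding nonsingular_def by auto
  qed
  obtain u0 :: 'a where u0: "u0 \<in> sphere 0 1" "\<And>u. u \<in> sphere 0 1 \<Longrightarrow> (\<integral>p. ?h u0 p \<partial>?D) \<le> (\<integral>p. ?h u p \<partial>?D)"
    using continuous_attains_inf[OF compact_sphere _ cont] by (auto simp: sphere_eq_empty)
  define c where "c = (\<integral>p. ?h u0 p \<partial>?D)"
  have c: "c > 0" "\<And>u. norm u = 1 \<Longrightarrow> c \<le> (\<integral>p. ?h u p \<partial>?D)"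
    using u0 pos by (auto simp: c_def)
  have "(\<lambda>n. measure ?D {p \<in> space ?D. real n < norm (?d p)}) \<longlonglongrightarrow> measure ?D (\<Inter>n. {p \<in> space ?D. real n < norm (?d p)})"
    by (rule D.finite_Lim_measure_decseq) (auto simp: decseq_def intro: le_less_trans)
  also have "(\<Inter>n. {p \<in> space ?D. real n < norm (?d p)}) = {}"
    by auto (meson linorder_not_less real_arch_simple)
  finally have "(\<lambda>n. measure ?D {p \<in> space ?D. real n < norm (?d p)}) \<longlonglongrightarrow> 0" by simp
  then have "\<forall>\<^sub>F n in sequentially. measure ?D {p \<in> space ?D. real n < norm (?d p)} < c / 2"
    using c(1) by (intro order_tendstoD) auto
  then obtain n0 where n0: "\<And>n. n \<ge> n0 \<Longrightarrow> measure ?D {p \<in> space ?D. real n < norm (?d p)} < c / 2"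
    by (auto simp: eventually_sequentially)
  define R where "R = real (Suc n0)"
  have R: "R > 0" "measure ?D {p \<in> space ?D. R < norm (?d p)} < c / 2"
    using n0[of "Suc n0"] by (auto simp: R_def)
  let ?J = "\<lambda>p. indicator {p. norm (?d p) \<le> R} p :: real"
  \<comment> \<open>Truncating at distance R loses less than half of the mass of the damped form.\<close>
  have trunc: "c / 2 \<le> (\<integral>p. ?J p * ?h u p \<partial>?D)" if u: "norm u = 1" for u
  proof -
    have "(\<integral>p. ?h u p \<partial>?D) \<le> (\<integral>p. ?J p * ?h u p + indicator {p \<in> space ?D. R < norm (?d p)} p \<partial>?D)"
    proof (rule integral_mono)
      show "integrable ?D (\<lambda>p. ?J p * ?h u p + indicator {p \<in> space ?D. R < norm (?d p)} p)"
        using h1[OF u] by (intro Bochner_Integration.integrable_add D.integrable_const_bound[of _ 1])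
          (auto simp: indicator_def)
      show "?h u p \<le> ?J p * ?h u p + indicator {p \<in> space ?D. R < norm (?d p)} p" if "p \<in> space ?D" for p
        using h1[OF u, of p] that by (auto simp: indicator_def)
    qed (rule inth[OF u])
    also have "\<dots> = (\<integral>p. ?J p * ?h u p \<partial>?D) + measure ?D {p \<in> space ?D. R < norm (?d p)}"
      using h1[OF u] by (subst Bochner_Integration.integral_add)
         (auto intro!: D.integrable_const_bound[of _ 1] simp: indicator_def[of "{p. norm (?d p) \<le> R}"])
    finally show ?thesis using R c(2)[OF u] by simp
  qed
  have sq: "(norm (chf \<mu> t))\<^sup>2 = (\<integral>p. cos (t \<bullet> ?d p) \<partial>?D)" for t
  proof -
    have int: "integrable \<mu> (\<lambda>s. iexp (t \<bullet> s))"
      by (intro \<mu>.integrable_const_bound[of _ 1]) auto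
    have e: "iexp (t \<bullet> (x - y)) = iexp (t \<bullet> x) * cnj (iexp (t \<bullet> y))" for x y
      by (simp add: inner_diff_right exp_cnj exp_add[symmetric] algebra_simps)
    have intp: "integrable ?D (\<lambda>p. iexp (t \<bullet> ?d p))"
      by (intro D.integrable_const_bound[of _ 1]) auto
    have "complex_of_real ((norm (chf \<mu> t))\<^sup>2) = chf \<mu> t * cnj (chf \<mu> t)"
      by (rule complex_norm_square)
    also have "\<dots> = (\<integral>x. \<integral>y. iexp (t \<bullet> x) * cnj (iexp (t \<bullet> y)) \<partial>\<mu> \<partial>\<mu>)"
      using int unfolding chf_def by simp
    also have "\<dots> = (\<integral>p. iexp (t \<bullet> ?d p) \<partial>?D)"
      unfolding e[symmetric] using intp by (subst D.integral_fst'[symmetric]) auto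
    finally have "(norm (chf \<mu> t))\<^sup>2 = Re (\<integral>p. iexp (t \<bullet> ?d p) \<partial>?D)"
      by (metis Re_complex_of_real)
    also have "\<dots> = (\<integral>p. cos (t \<bullet> ?d p) \<partial>?D)"
      using integral_Re[OF intp] by (simp add: Re_exp)
    finally show ?thesis .
  qed
  have main: "norm (chf \<mu> t) \<le> exp (- (c / 32) * (norm t)\<^sup>2)" if t: "norm t \<le> 1 / R" for t
  proof (cases "t = 0")
    case True
    then show ?thesis by (simp add: chf_def \<mu>.prob_space)
  next
    case False
    define u where "u = t /\<^sub>R norm t"
    have u: "norm u = 1" "t = norm t *\<^sub>R u" using False by (auto simp: u_def)
    have "(norm t)\<^sup>2 / 8 * (c / 2) \<le> (norm t)\<^sup>2 / 8 * (\<integral>p. ?J p * ?h u p \<partial>?D)"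
      using trunc[OF u(1)] by (intro mult_left_mono) auto
    also have "\<dots> = (\<integral>p. (norm t)\<^sup>2 / 8 * (?J p * ?h u p) \<partial>?D)"
      by (rule integral_mult_right_zero[symmetric])
    also have "\<dots> \<le> (\<integral>p. 1 - cos (t \<bullet> ?d p) \<partial>?D)"
    proof (rule integral_mono)
      show "integrable ?D (\<lambda>p. (norm t)\<^sup>2 / 8 * (?J p * ?h u p))"
        using h1[OF u(1)] by (intro integrable_mult_right D.integrable_const_bound[of _ 1]) (auto simp: indicator_def)
      show "integrable ?D (\<lambda>p. 1 - cos (t \<bullet> ?d p))"
        by (intro Bochner_Integration.integrable_diff D.integrable_const_bound[of _ 1]) auto
      show "(norm t)\<^sup>2 / 8 * (?J p * ?h u p) \<le> 1 - cos (t \<bullet> ?d p)" for p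
      proof (cases "norm (?d p) \<le> R")
        case True
        have "\<bar>t \<bullet> ?d p\<bar> \<le> norm t * norm (?d p)" by (rule Cauchy_Schwarz_ineq2)
        also have "\<dots> \<le> 1 / R * R" using t True R by (intro mult_mono) auto
        finally have 1: "\<bar>t \<bullet> ?d p\<bar> \<le> 1" using R by simp
        have "?h u p \<le> (u \<bullet> ?d p)\<^sup>2 / 1"
          by (intro divide_left_mono) (auto intro: add_pos_nonneg)
        then have "(norm t)\<^sup>2 / 8 * ?h u p \<le> (norm t)\<^sup>2 / 8 * (u \<bullet> ?d p)\<^sup>2"
          by (intro mult_left_mono) auto
        also have "\<dots> = (t \<bullet> ?d p)\<^sup>2 / 8"
        proof -
          have "t \<bullet> ?d p = norm t * (u \<bullet> ?d p)" by (metis u(2) inner_scaleR_left)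
          then show ?thesis by (simp add: power_mult_distrib)
        qed
        also have "\<dots> \<le> 1 - cos (t \<bullet> ?d p)" by (rule one_minus_cos_ge[OF 1])
        finally show ?thesis using True by simp
      qed simp
    qed
    also have "\<dots> = 1 - (norm (chf \<mu> t))\<^sup>2"
      unfolding sq by (subst Bochner_Integration.integral_diff)
        (auto intro!: D.integrable_const_bound[of _ 1] simp: D.prob_space)
    finally have "(norm (chf \<mu> t))\<^sup>2 \<le> 1 + (- (c / 16) * (norm t)\<^sup>2)" by (simp add: field_simps)
    also have "\<dots> \<le> exp (- (c / 16) * (norm t)\<^sup>2)" by (rule exp_ge_add_one_self)
    also have "\<dots> = (exp (- (c / 32) * (norm t)\<^sup>2))\<^sup>2"
      by (simp add: power2_eq_square exp_add[symmetric])
    finally show ?thesis by (rule power2_le_imp_le) simp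
  qed
  show thesis
    by (rule that[of "c / 32" "1 / R"]) (use c R main in auto)
qed

text \<open>This makes the product formula for characteristic functions of sums on the real line available.\<close>
lemma chf_distr:
  fixes X :: "'w \<Rightarrow> 'a::euclidean_space"
  assumes "X \<in> borel_measurable M"
  shows "chf (distr M borel X) t = char (distr M borel (\<lambda>\<omega>. t \<bullet> X \<omega>)) 1"
  using assms by (simp add: chf_def char_def integral_distr)

section \<open>Independent coordinates of product spaces\<close>

text \<open>Only the law of \<open>X\<close> matters, so both facts reduce to the coordinates of the product space itself. In this
form they also apply to the projections of the canonical space.\<close>
lemma (in prob_space)
  assumes "I \<noteq> {}" and K: "\<And>i. i \<in> I \<Longrightarrow> prob_space (K i)"
    and X: "X \<in> M \<rightarrow>\<^sub>M PiM I K" and law: "distr M (PiM I K) X = PiM I K"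
  shows indep_vars_if_distr_eq_PiM: "indep_vars K (\<lambda>i \<omega>. X \<omega> i) I"
    and distr_component_if_distr_eq_PiM: "i \<in> I \<Longrightarrow> distr M (K i) (\<lambda>\<omega>. X \<omega> i) = K i"
proof -
  have comp: "(\<lambda>\<omega>. X \<omega> i) \<in> M \<rightarrow>\<^sub>M K i" if "i \<in> I" for i
    using X that by measurable
  show 1: "distr M (K i) (\<lambda>\<omega>. X \<omega> i) = K i" if "i \<in> I" for i
  proof -
    have "distr M (K i) (\<lambda>\<omega>. X \<omega> i) = distr (distr M (PiM I K) X) (K i) (\<lambda>f. f i)"
      using X that by (subst distr_distr) (auto simp: o_def)
    then show ?thesis
      using distr_PiM_component[OF K that] law by simp
  qed
  have "distr M (PiM I K) (\<lambda>\<omega>. \<lambda>i\<in>I. X \<omega> i) = distr M (PiM I K) X"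
    using measurable_space[OF X] by (intro distr_cong) (auto simp: space_PiM PiE_def extensional_restrict)
  also have "\<dots> = PiM I (\<lambda>i. distr M (K i) (\<lambda>\<omega>. X \<omega> i))"
    unfolding law by (intro PiM_cong refl 1[symmetric])
  finally show "indep_vars K (\<lambda>i \<omega>. X \<omega> i) I"
    using assms(1) comp by (subst indep_vars_iff_distr_eq_PiM') auto
qed

lemma indep_vars_sets_cong:
  assumes "prob_space.indep_vars M K X I" "prob_space M" "\<And>i. i \<in> I \<Longrightarrow> sets (K i) = sets (K' i)"
  shows "prob_space.indep_vars M K' X I"
proof -
  interpret prob_space M by fact
  show ?thesis
    by (rule indep_vars_compose2[OF assms(1), of "\<lambda>_ x. x"]) (simp add: measurable_ident_sets assms(3))
qed

lemma indep_vars_PiM_components: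
  assumes "I \<noteq> {}" and M: "\<And>i. i \<in> I \<Longrightarrow> prob_space (M i)"
  shows "prob_space.indep_vars (PiM I M) M (\<lambda>i \<omega>. \<omega> i) I"
proof -
  interpret prob_space "PiM I M" by (rule prob_space_PiM) (rule M)
  show ?thesis
    using assms by (intro indep_vars_if_distr_eq_PiM) auto
qed

section \<open>The walk given the transformations and the choices\<close>

lemma measurable_srrw_step:
  fixes g :: "nat \<Rightarrow> 'w \<Rightarrow> 'a::euclidean_space"
  assumes g: "\<And>n. 1 \<le> n \<Longrightarrow> g n \<in> P \<rightarrow>\<^sub>M borel"
    and \<xi>: "\<And>n. 2 \<le> n \<Longrightarrow> \<xi> n \<in> P \<rightarrow>\<^sub>M count_space UNIV"
    and u: "\<And>n. 2 \<le> n \<Longrightarrow> u n \<in> P \<rightarrow>\<^sub>M count_space {1..n-1}"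
    and T: "\<And>n. 2 \<le> n \<Longrightarrow> (\<lambda>(p, x). T n p x) \<in> P \<Otimes>\<^sub>M borel \<rightarrow>\<^sub>M borel"
  shows "1 \<le> n \<Longrightarrow> srrw_step g \<xi> u T n \<in> P \<rightarrow>\<^sub>M borel"
proof (induction n rule: less_induct)
  case (less n)
  show ?case
  proof (cases "2 \<le> n")
    case False
    then have "srrw_step g \<xi> u T n = g n"
      by (intro ext) (simp add: srrw_step.simps[of _ _ _ _ n])
    then show ?thesis using g less.prems by simp
  next
    case True
    note [measurable] = g[OF less.prems] \<xi>[OF True]
    have "(\<lambda>p. srrw_step g \<xi> u T (u n p) p) \<in> P \<rightarrow>\<^sub>M borel"
      by (rule measurable_compose_countable'[OF _ u[OF True]]) (use less.IH True in auto)
    then have [measurable]: "(\<lambda>p. T n p (srrw_step g \<xi> u T (u n p) p)) \<in> P \<rightarrow>\<^sub>M borel"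
      using measurable_compose[OF measurable_Pair[OF measurable_ident] T[OF True]] by simp
    have "(\<lambda>p. if \<xi> n p then T n p (srrw_step g \<xi> u T (u n p) p) else g n p) \<in> P \<rightarrow>\<^sub>M borel"
      by measurable
    moreover have "u n p < n" if "p \<in> space P" for p
      using measurable_space[OF u[OF True] that] True by auto
    then have "\<And>p. p \<in> space P \<Longrightarrow> srrw_step g \<xi> u T n p =
        (if \<xi> n p then T n p (srrw_step g \<xi> u T (u n p) p) else g n p)"
      using True by (subst srrw_step.simps) simp
    ultimately show ?thesis
      by (subst measurable_cong[where g="\<lambda>p. if \<xi> n p then T n p (srrw_step g \<xi> u T (u n p) p) else g n p"]) auto
  qed
qed

lemma srrw_step_cong:
  assumes "\<And>n. 1 \<le> n \<Longrightarrow> g n \<omega> = g' n \<omega>'"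
    and "\<And>n. 2 \<le> n \<Longrightarrow> \<xi> n \<omega> = \<xi>' n \<omega>'"
    and "\<And>n. 2 \<le> n \<Longrightarrow> u n \<omega> = u' n \<omega>'"
    and "\<And>n. 2 \<le> n \<Longrightarrow> u n \<omega> \<in> {1..n-1}"
    and "\<And>n. 2 \<le> n \<Longrightarrow> T n \<omega> = T' n \<omega>'"
  shows "1 \<le> n \<Longrightarrow> srrw_step g \<xi> u T n \<omega> = srrw_step g' \<xi>' u' T' n \<omega>'"
proof (induction n rule: less_induct)
  case (less n)
  show ?case
  proof (cases "2 \<le> n")
    case True
    have "u' n \<omega>' < n" "1 \<le> u' n \<omega>'" using assms(3,4)[OF True] True by auto
    then show ?thesis
      using less.IH[of "u' n \<omega>'"] assms(1)[OF less.prems] assms(2,3,5)[OF True] True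
      by (subst (1 2) srrw_step.simps) simp
  next
    case False
    then show ?thesis using assms(1)[OF less.prems] by (subst (1 2) srrw_step.simps) simp
  qed
qed

definition canonical_step ::
  "(nat \<Rightarrow> 'a \<Rightarrow> 'a) \<Rightarrow> nat \<Rightarrow> 'a canonical_space \<Rightarrow> 'a" where
  "canonical_step t = srrw_step (\<lambda>k p. fst p k) (\<lambda>k p. fst (snd p) k) (\<lambda>k p. snd (snd p) k) (\<lambda>k _. t k)"

definition canonical_walk ::
  "(nat \<Rightarrow> 'a::comm_monoid_add \<Rightarrow> 'a) \<Rightarrow> nat \<Rightarrow> 'a canonical_space \<Rightarrow> 'a" where
  "canonical_walk t = srrw (\<lambda>k p. fst p k) (\<lambda>k p. fst (snd p) k) (\<lambda>k p. snd (snd p) k) (\<lambda>k _. t k)"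

lemma canonical_walk_eq_sum: "canonical_walk t n p = (\<Sum>k=1..n. canonical_step t k p)"
  by (simp add: canonical_walk_def canonical_step_def srrw_def)

lemma canonical_step_rec:
  assumes "1 \<le> k" "2 \<le> k \<Longrightarrow> v k < k"
  shows "canonical_step t k (\<gamma>, x, v) =
    (if 2 \<le> k \<and> x k then t k (canonical_step t (v k) (\<gamma>, x, v)) else \<gamma> k)"
  using assms unfolding canonical_step_def by (subst srrw_step.simps) simp

text \<open>Join each \<open>j \<ge> 2\<close> with \<open>x j\<close> to the earlier time \<open>v j\<close> that it copies. On the times up to \<open>n\<close> this is a
forest, and \<open>isolated x v n\<close> is the set of its one-point trees: the fresh steps that have not been copied.
Time \<open>1\<close> is fresh whatever the value of \<open>x\<close> there.\<close>
definition isolated :: "(nat \<Rightarrow> bool) \<Rightarrow> (nat \<Rightarrow> nat) \<Rightarrow> nat \<Rightarrow> nat set" where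
  "isolated x v n = {k \<in> {1..n}. (2 \<le> k \<longrightarrow> \<not> x k) \<and> (\<forall>j\<in>{2..n}. x j \<longrightarrow> v j \<noteq> k)}"

lemma canonical_step_isolated:
  assumes v: "\<And>k. 2 \<le> k \<Longrightarrow> v k \<in> {1..k-1}" and k: "k \<in> isolated x v n"
  shows "canonical_step t k (\<gamma>, x, v) = \<gamma> k"
  using k v[of k] by (subst canonical_step_rec) (auto simp: isolated_def)

text \<open>A step that is not isolated never sees the value at an isolated time: the time that it copies is not
isolated, by definition. This makes the steps outside \<open>isolated x v n\<close> jointly independent of those
inside.\<close>
lemma canonical_step_not_isolated:
  assumes v: "\<And>k. 2 \<le> k \<Longrightarrow> v k \<in> {1..k-1}"
    and eq: "\<And>k. k \<in> {1..} - isolated x v n \<Longrightarrow> \<gamma> k = \<gamma>' k"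
  shows "k \<in> {1..n} - isolated x v n \<Longrightarrow> canonical_step t k (\<gamma>, x, v) = canonical_step t k (\<gamma>', x, v)"
proof (induction k rule: less_induct)
  case (less k)
  show ?case
  proof (cases "2 \<le> k \<and> x k")
    case True
    then have vk: "v k \<in> {1..k-1}" using v by simp
    moreover have "v k \<notin> isolated x v n"
      using True less.prems by (auto simp: isolated_def)
    ultimately have "canonical_step t (v k) (\<gamma>, x, v) = canonical_step t (v k) (\<gamma>', x, v)"
      using less.prems True by (intro less.IH) auto
    then show ?thesis
      using True vk by (subst (1 2) canonical_step_rec) auto
  next
    case False
    then show ?thesis
      using less.prems v[of k] eq[of k] by (subst (1 2) canonical_step_rec) auto
  qed
qed

lemma measurable_canonical_walk:
  fixes t :: "nat \<Rightarrow> 'a::euclidean_space \<Rightarrow> 'a"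
  assumes "\<And>k. 2 \<le> k \<Longrightarrow> t k \<in> borel \<rightarrow>\<^sub>M borel"
    and "\<And>k. 1 \<le> k \<Longrightarrow> (\<lambda>\<omega>. G \<omega> k) \<in> P \<rightarrow>\<^sub>M borel"
    and "\<And>k. 2 \<le> k \<Longrightarrow> (\<lambda>\<omega>. X \<omega> k) \<in> P \<rightarrow>\<^sub>M count_space UNIV"
    and "\<And>k. 2 \<le> k \<Longrightarrow> (\<lambda>\<omega>. V \<omega> k) \<in> P \<rightarrow>\<^sub>M count_space {1..k-1}"
  shows "1 \<le> k \<Longrightarrow> (\<lambda>\<omega>. canonical_step t k (G \<omega>, X \<omega>, V \<omega>)) \<in> P \<rightarrow>\<^sub>M borel"
    and "(\<lambda>\<omega>. canonical_walk t n (G \<omega>, X \<omega>, V \<omega>)) \<in> P \<rightarrow>\<^sub>M borel"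
proof -
  have V: "V \<omega> k \<in> {1..k-1}" if "\<omega> \<in> space P" "2 \<le> k" for k \<omega>
    using measurable_space[OF assms(4) that(1)] that(2) by simp
  have *: "(\<lambda>\<omega>. canonical_step t k (G \<omega>, X \<omega>, V \<omega>)) \<in> P \<rightarrow>\<^sub>M borel" if k: "1 \<le> k" for k
  proof -
    have "srrw_step (\<lambda>k \<omega>. G \<omega> k) (\<lambda>k \<omega>. X \<omega> k) (\<lambda>k \<omega>. V \<omega> k) (\<lambda>k _. t k) k \<in> P \<rightarrow>\<^sub>M borel"
    proof (rule measurable_srrw_step[OF assms(2-4) _ k])
      fix n :: nat assume "2 \<le> n"
      from assms(1)[OF this] show "(\<lambda>(p, y). t n y) \<in> P \<Otimes>\<^sub>M borel \<rightarrow>\<^sub>M borel" by measurable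
    qed
    moreover have "srrw_step (\<lambda>k \<omega>. G \<omega> k) (\<lambda>k \<omega>. X \<omega> k) (\<lambda>k \<omega>. V \<omega> k) (\<lambda>k _. t k) k \<omega>
        = canonical_step t k (G \<omega>, X \<omega>, V \<omega>)" if "\<omega> \<in> space P" for \<omega>
      unfolding canonical_step_def by (rule srrw_step_cong[OF _ _ _ _ _ k]) (use V[OF that] in auto)
    ultimately show ?thesis by (simp cong: measurable_cong)
  qed
  then show "1 \<le> k \<Longrightarrow> (\<lambda>\<omega>. canonical_step t k (G \<omega>, X \<omega>, V \<omega>)) \<in> P \<rightarrow>\<^sub>M borel" .
  show "(\<lambda>\<omega>. canonical_walk t n (G \<omega>, X \<omega>, V \<omega>)) \<in> P \<rightarrow>\<^sub>M borel"
    unfolding canonical_walk_eq_sum using * by (intro borel_measurable_sum) auto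
qed

text \<open>The walk is the sum of the isolated steps, which are i.i.d. with law \<open>\<mu>\<close>, and a remainder that is a
function of the other coordinates and therefore independent of them. Each isolated step contributes a
factor \<open>chf \<mu> s\<close>, and the remainder a factor of modulus at most \<open>1\<close>, whatever the transformations are.\<close>
lemma chf_canonical_walk_le:
  fixes \<mu> :: "'a::euclidean_space measure"
  assumes \<mu>: "prob_space \<mu>" and S[measurable_cong]: "sets \<mu> = sets borel"
    and t: "\<And>k. 2 \<le> k \<Longrightarrow> t k \<in> borel \<rightarrow>\<^sub>M borel"
    and v: "\<And>k. 2 \<le> k \<Longrightarrow> v k \<in> {1..k-1}"
  shows "norm (chf (distr (PiM {1..} (\<lambda>_. \<mu>)) borel (\<lambda>\<gamma>. canonical_walk t n (\<gamma>, x, v))) s)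
      \<le> norm (chf \<mu> s) ^ card (isolated x v n)"
proof -
  let ?G = "PiM {1::nat..} (\<lambda>_. \<mu>)"
  let ?I = "isolated x v n"
  interpret prob_space ?G by (rule prob_space_PiM) (rule \<mu>)
  define R where "R f = (\<Sum>k\<in>{1..n} - ?I. canonical_step t k (f, x, v))" for f
  \<comment> \<open>Blocks of coordinates: a singleton for each isolated time, and all other coordinates in the block
    indexed by 0, which is not a time of the walk.\<close>
  define K where "K j = (if j = 0 then {1..} - ?I else {j})" for j
  have I: "?I \<subseteq> {1..n}" "finite ?I" "0 \<notin> ?I"
    by (auto simp: isolated_def)
  have meas: "(\<lambda>\<omega>. canonical_step t k (f \<omega>, x, v)) \<in> P \<rightarrow>\<^sub>M borel"
    if "1 \<le> k" "\<And>k. 1 \<le> k \<Longrightarrow> (\<lambda>\<omega>. f \<omega> k) \<in> P \<rightarrow>\<^sub>M borel" for P :: "'b measure" and f k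
    by (rule measurable_canonical_walk(1)[OF t that(2) _ _ that(1)]) (use v in auto)
  have R_restrict: "R (restrict \<gamma> ({1..} - ?I)) = R \<gamma>" for \<gamma>
    unfolding R_def by (intro sum.cong refl canonical_step_not_isolated[OF v]) auto
  have split: "canonical_walk t n (\<gamma>, x, v) = (\<Sum>k\<in>?I. \<gamma> k) + R \<gamma>" for \<gamma>
    unfolding canonical_walk_eq_sum R_def using I(1)
    by (subst sum.subset_diff[of ?I]) (auto simp: add.commute canonical_step_isolated[OF v])
  have "indep_vars (\<lambda>_. \<mu>) (\<lambda>k \<gamma>. \<gamma> k) {1..}"
    using indep_vars_PiM_components[of "{1::nat..}" "\<lambda>_. \<mu>"] \<mu> by auto
  then have blocks: "indep_vars (\<lambda>j. PiM (K j) (\<lambda>_. \<mu>)) (\<lambda>j \<gamma>. restrict (\<lambda>k. \<gamma> k) (K j)) (insert 0 ?I)"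
    by (rule indep_vars_restrict) (use I in \<open>auto simp: K_def disjoint_family_on_def\<close>)
  define Y where "Y j f = s \<bullet> (if j = 0 then R (restrict f ({1..} - ?I)) else f j)" for j f
  have "indep_vars (\<lambda>_. borel) (\<lambda>j \<gamma>. Y j (restrict (\<lambda>k. \<gamma> k) (K j))) (insert 0 ?I)"
  proof (rule indep_vars_compose2[OF blocks])
    fix j assume j: "j \<in> insert 0 ?I"
    show "Y j \<in> PiM (K j) (\<lambda>_. \<mu>) \<rightarrow>\<^sub>M borel"
    proof (cases "j = 0")
      case True
      have rm: "(\<lambda>f. restrict f ({1..} - ?I) k) \<in> PiM ({1..} - ?I) (\<lambda>_. \<mu>) \<rightarrow>\<^sub>M borel" for k
        by (cases "k \<in> {1..} - ?I") (auto simp del: Diff_iff)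
      have "(\<lambda>f. s \<bullet> R (restrict f ({1..} - ?I))) \<in> PiM ({1..} - ?I) (\<lambda>_. \<mu>) \<rightarrow>\<^sub>M borel"
        unfolding R_def
        by (intro borel_measurable_inner borel_measurable_const borel_measurable_sum meas rm) auto
      then show ?thesis
        unfolding Y_def K_def using True by simp
    next
      case False
      have "(\<lambda>f. f j) \<in> PiM {j} (\<lambda>_. \<mu>) \<rightarrow>\<^sub>M borel" by measurable
      then show ?thesis
        unfolding Y_def K_def using False by simp
    qed
  qed
  moreover have "Y j (restrict (\<lambda>k. \<gamma> k) (K j)) = s \<bullet> (if j = 0 then R \<gamma> else \<gamma> j)" for j \<gamma>
    unfolding Y_def K_def using R_restrict by simp
  ultimately have ind: "indep_vars (\<lambda>_. borel) (\<lambda>j \<gamma>. s \<bullet> (if j = 0 then R \<gamma> else \<gamma> j)) (insert 0 ?I)"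
    by simp
  have walk: "(\<lambda>\<gamma>. canonical_walk t n (\<gamma>, x, v)) \<in> ?G \<rightarrow>\<^sub>M borel"
    by (rule measurable_canonical_walk(2)[OF t]) (use v in auto)
  have "s \<bullet> canonical_walk t n (\<gamma>, x, v) = (\<Sum>j\<in>insert 0 ?I. s \<bullet> (if j = 0 then R \<gamma> else \<gamma> j))" for \<gamma>
    using I by (simp add: split inner_add_right inner_sum_right) (auto intro!: sum.cong)
  then have "chf (distr ?G borel (\<lambda>\<gamma>. canonical_walk t n (\<gamma>, x, v))) s
      = (\<Prod>j\<in>insert 0 ?I. char (distr ?G borel (\<lambda>\<gamma>. s \<bullet> (if j = 0 then R \<gamma> else \<gamma> j))) 1)"
    by (simp only: chf_distr[OF walk] char_distr_sum[OF ind])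
  also have "\<dots> = char (distr ?G borel (\<lambda>\<gamma>. s \<bullet> R \<gamma>)) 1 * (\<Prod>j\<in>?I. char (distr ?G borel (\<lambda>\<gamma>. s \<bullet> \<gamma> j)) 1)"
    using I by simp (intro disjI2 prod.cong, auto)
  also have "(\<Prod>j\<in>?I. char (distr ?G borel (\<lambda>\<gamma>. s \<bullet> \<gamma> j)) 1) = (\<Prod>j\<in>?I. chf \<mu> s)"
  proof (rule prod.cong[OF refl])
    fix j assume "j \<in> ?I"
    then have j: "j \<in> {1..}" using I by auto
    then have "distr ?G borel (\<lambda>\<gamma>. \<gamma> j) = \<mu>"
      using distr_PiM_component[of "{1..}" "\<lambda>_. \<mu>" j] \<mu> S by (metis distr_cong)
    moreover have "(\<lambda>\<gamma>. \<gamma> j) \<in> borel_measurable ?G" using j by measurable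
    ultimately show "char (distr ?G borel (\<lambda>\<gamma>. s \<bullet> \<gamma> j)) 1 = chf \<mu> s"
      using chf_distr[of "\<lambda>\<gamma>. \<gamma> j" ?G s] by simp
  qed
  finally have eq: "norm (chf (distr ?G borel (\<lambda>\<gamma>. canonical_walk t n (\<gamma>, x, v))) s)
      = norm (char (distr ?G borel (\<lambda>\<gamma>. s \<bullet> R \<gamma>)) 1) * norm (chf \<mu> s) ^ card ?I"
    by (simp add: norm_mult norm_power)
  have "(\<lambda>\<gamma>. s \<bullet> R \<gamma>) \<in> ?G \<rightarrow>\<^sub>M borel"
    unfolding R_def by (intro borel_measurable_inner borel_measurable_sum meas) auto
  then have "real_distribution (distr ?G borel (\<lambda>\<gamma>. s \<bullet> R \<gamma>))"
    by (rule real_distribution_distr)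
  from real_distribution.cmod_char_le_1[OF this, of 1] show ?thesis
    unfolding eq by (intro mult_left_le_one_le) auto
qed

text \<open>The characteristic function of the walk, given the choices \<open>x\<close> and \<open>v\<close>, is below
\<open>exp (- c L \<bar>s\<bar>\<^sup>2)\<close> for small \<open>s\<close>, where \<open>L\<close> is the number of isolated times, and the Gaussian
integral with parameter \<open>c L\<close> is proportional to \<open>L\<close> to the power \<open>- d / 2\<close>.\<close>
lemma canonical_walk_ball_le:
  fixes \<mu> :: "'a::euclidean_space measure"
  assumes \<mu>: "prob_space \<mu>" and S: "sets \<mu> = sets borel" and ns: "nonsingular \<mu>" and r: "r > 0"
  obtains K where "K > 0"
    "\<And>t x v n z. \<lbrakk>\<And>k. 2 \<le> k \<Longrightarrow> t k \<in> borel \<rightarrow>\<^sub>M borel; \<And>k. 2 \<le> k \<Longrightarrow> v k \<in> {1..k-1}; isolated x v n \<noteq> {}\<rbrakk>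
      \<Longrightarrow> measure (PiM {1..} (\<lambda>_. \<mu>)) {\<gamma> \<in> space (PiM {1..} (\<lambda>_. \<mu>)). canonical_walk t n (\<gamma>, x, v) \<in> ball z r}
        \<le> K * real (card (isolated x v n)) powr (- (real DIM('a) / 2))"
proof -
  from chf_gaussian_decay[OF \<mu> S ns] obtain c \<delta>\<^sub>0 where c: "c > 0" "\<delta>\<^sub>0 > 0"
    "\<And>t. norm t \<le> \<delta>\<^sub>0 \<Longrightarrow> norm (chf \<mu> t) \<le> exp (- c * (norm t)\<^sup>2)" by blast
  define \<delta> where "\<delta> = min (\<delta>\<^sub>0 / 2) (1 / r)"
  have \<delta>: "\<delta> > 0" "2 * \<delta> \<le> \<delta>\<^sub>0" "\<delta> * r \<le> 1"
    using c r by (auto simp: \<delta>_def min_def field_simps)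
  define K where "K = 4 / measure lborel (ball (0::'a) \<delta>) * sqrt (pi / c) ^ DIM('a)"
  have K: "K > 0" using c \<delta> by (simp add: K_def)
  moreover have "measure (PiM {1..} (\<lambda>_. \<mu>)) {\<gamma> \<in> space (PiM {1..} (\<lambda>_. \<mu>)). canonical_walk t n (\<gamma>, x, v) \<in> ball z r}
        \<le> K * real (card (isolated x v n)) powr (- (real DIM('a) / 2))"
    if t: "\<And>k. 2 \<le> k \<Longrightarrow> t k \<in> borel \<rightarrow>\<^sub>M borel" and v: "\<And>k. 2 \<le> k \<Longrightarrow> v k \<in> {1..k-1}"
      and ne: "isolated x v n \<noteq> {}" for t x v n z
  proof -
    define L where "L = card (isolated x v n)"
    have "finite (isolated x v n)" by (simp add: isolated_def)
    then have L: "L > 0" using ne by (simp add: L_def card_gt_0_iff)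
    let ?G = "PiM {1::nat..} (\<lambda>_. \<mu>)"
    let ?\<nu> = "distr ?G borel (\<lambda>\<gamma>. canonical_walk t n (\<gamma>, x, v))"
    interpret G: prob_space ?G by (rule prob_space_PiM) (rule \<mu>)
    have [measurable_cong]: "sets \<mu> = sets borel" by (rule S)
    have walk: "(\<lambda>\<gamma>. canonical_walk t n (\<gamma>, x, v)) \<in> ?G \<rightarrow>\<^sub>M borel"
      by (rule measurable_canonical_walk(2)[OF t]) (use v in auto)
    have "norm (chf ?\<nu> s) \<le> exp (- (c * L) * (norm s)\<^sup>2)" if "norm s \<le> 2 * \<delta>" for s
    proof -
      have "norm (chf ?\<nu> s) \<le> norm (chf \<mu> s) ^ L"
        unfolding L_def by (rule chf_canonical_walk_le[OF \<mu> S t v])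
      also have "\<dots> \<le> exp (- c * (norm s)\<^sup>2) ^ L"
        using c(3)[of s] that \<delta> by (intro power_mono) auto
      also have "\<dots> = exp (- (c * L) * (norm s)\<^sup>2)"
        by (simp add: exp_of_nat_mult[symmetric])
      finally show ?thesis .
    qed
    then have "measure ?\<nu> (ball z r) \<le> 4 / measure lborel (ball (0::'a) \<delta>) * sqrt (pi / (c * L)) ^ DIM('a)"
      using c \<delta> L by (intro small_ball_le_gaussian G.prob_space_distr walk) auto
    also have "\<dots> = K * (1 / sqrt L) ^ DIM('a)"
      by (simp add: K_def real_sqrt_divide real_sqrt_mult power_divide power_mult_distrib)
    also have "(1 / sqrt L) ^ DIM('a) = real L powr (- (real DIM('a) / 2))"
    proof -
      have "1 / sqrt L = real L powr (- (1 / 2))"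
        using L by (simp add: powr_minus_divide powr_half_sqrt)
      then show ?thesis
        using L by (simp add: powr_power)
    qed
    also have "measure ?\<nu> (ball z r) = measure ?G {\<gamma> \<in> space ?G. canonical_walk t n (\<gamma>, x, v) \<in> ball z r}"
      by (subst measure_distr[OF walk]) (auto simp: vimage_def Int_def conj_commute)
    finally show ?thesis by (simp only: L_def)
  qed
  ultimately show thesis by (rule that)
qed

section \<open>The number of isolated times\<close>

text \<open>A fresh time \<open>k\<close> in the window \<open>{m<..n}\<close> fails to be isolated only if a later \<open>j\<close> copies it. Then
\<open>m < k = v j < j\<close>, so that \<open>j\<close> lies in the window too, and distinct such \<open>k\<close> need distinct \<open>j\<close>. The
bound is a difference of two sums, one over \<open>x\<close> and one over \<open>v\<close>, each with independent summands.\<close>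
lemma card_isolated_ge:
  assumes m: "1 \<le> m" and v: "\<And>j. 2 \<le> j \<Longrightarrow> v j < j"
  shows "(\<Sum>j\<in>{m<..n}. of_bool (\<not> x j)) - (\<Sum>j\<in>{m<..n}. of_bool (m < v j)) \<le> real (card (isolated x v n))"
proof -
  let ?A = "{j\<in>{m<..n}. \<not> x j}" and ?B = "{j\<in>{m<..n}. m < v j}"
  have "?A \<subseteq> isolated x v n \<union> v ` ?B"
  proof
    fix k assume k: "k \<in> ?A"
    show "k \<in> isolated x v n \<union> v ` ?B"
    proof (cases "k \<in> isolated x v n")
      case False
      then obtain j where j: "j \<in> {2..n}" "v j = k"
        using k m by (auto simp: isolated_def)
      then have "j \<in> ?B" using k v[of j] by auto
      then show ?thesis using j by blast
    qed simp
  qed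
  then have "card ?A \<le> card (isolated x v n \<union> v ` ?B)"
    by (intro card_mono) (auto simp: isolated_def)
  also have "\<dots> \<le> card (isolated x v n) + card (v ` ?B)" by (rule card_Un_le)
  also have "card (v ` ?B) \<le> card ?B" by (rule card_image_le) simp
  finally have "real (card ?A) - real (card ?B) \<le> card (isolated x v n)" by simp
  then show ?thesis by (simp add: of_bool_def sum.If_cases Int_def)
qed

definition xi_space :: "real \<Rightarrow> (nat \<Rightarrow> bool) measure" where
  "xi_space \<alpha> = PiM {2..} (\<lambda>_. measure_pmf (bernoulli_pmf \<alpha>))"

definition u_space :: "(nat \<Rightarrow> nat) measure" where
  "u_space = PiM {2..} (\<lambda>n. uniform_count_measure {1..n-1})"

lemma prob_space_xi_space: "prob_space (xi_space \<alpha>)"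
  unfolding xi_space_def by (intro prob_space_PiM measure_pmf.prob_space_axioms)

lemma prob_space_u_space: "prob_space u_space"
  unfolding u_space_def by (intro prob_space_PiM prob_space_uniform_count_measure) auto

lemma Hoeffding_01:
  fixes M :: "'w measure" and X :: "'i \<Rightarrow> 'w \<Rightarrow> real" and \<epsilon> :: real
  assumes M: "prob_space M" and I: "finite I" "I \<noteq> {}"
    and ind: "prob_space.indep_vars M (\<lambda>_. borel) X I"
    and X: "\<And>i \<omega>. i \<in> I \<Longrightarrow> X i \<omega> \<in> {0..1}" and \<epsilon>: "\<epsilon> \<ge> 0"
  shows "measure M {\<omega>\<in>space M. (\<Sum>i\<in>I. X i \<omega>) \<le> (\<Sum>i\<in>I. integral\<^sup>L M (X i)) - \<epsilon> * card I} \<le> exp (-2 * \<epsilon>\<^sup>2 * card I)"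
    and "measure M {\<omega>\<in>space M. (\<Sum>i\<in>I. X i \<omega>) \<ge> (\<Sum>i\<in>I. integral\<^sup>L M (X i)) + \<epsilon> * card I} \<le> exp (-2 * \<epsilon>\<^sup>2 * card I)"
proof -
  interpret prob_space M by fact
  interpret Hoeffding_ineq M I X "\<lambda>_. 0" "\<lambda>_. 1" "\<Sum>i\<in>I. integral\<^sup>L M (X i)"
    by unfold_locales (use I ind X in auto)
  have n: "real (card I) > 0" using I by (simp add: card_gt_0_iff)
  have e: "- 2 * (\<epsilon> * card I)\<^sup>2 / (\<Sum>i\<in>I. (1 - 0)\<^sup>2) = - 2 * \<epsilon>\<^sup>2 * card I"
    using n by (simp add: power2_eq_square)
  show "measure M {\<omega>\<in>space M. (\<Sum>i\<in>I. X i \<omega>) \<le> (\<Sum>i\<in>I. integral\<^sup>L M (X i)) - \<epsilon> * card I} \<le> exp (-2 * \<epsilon>\<^sup>2 * card I)"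
    unfolding e[symmetric] by (rule Hoeffding_ineq_le) (use \<epsilon> n in auto)
  show "measure M {\<omega>\<in>space M. (\<Sum>i\<in>I. X i \<omega>) \<ge> (\<Sum>i\<in>I. integral\<^sup>L M (X i)) + \<epsilon> * card I} \<le> exp (-2 * \<epsilon>\<^sup>2 * card I)"
    unfolding e[symmetric] by (rule Hoeffding_ineq_ge) (use \<epsilon> n in auto)
qed

text \<open>Hoeffding's inequality below the mean \<open>(1 - \<alpha>) (n - m)\<close> of the number of fresh times in the window.\<close>
lemma xi_space_few_fresh:
  assumes \<alpha>: "0 \<le> \<alpha>" "\<alpha> \<le> 1" and m: "1 \<le> m" "m < n" and \<epsilon>: "0 \<le> \<epsilon>"
  shows "measure (xi_space \<alpha>) {x \<in> space (xi_space \<alpha>).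
      (\<Sum>j\<in>{m<..n}. of_bool (\<not> x j)) \<le> (1 - \<alpha> - \<epsilon>) * (real n - real m)} \<le> exp (- 2 * \<epsilon>\<^sup>2 * (real n - real m))"
proof -
  let ?B = "measure_pmf (bernoulli_pmf \<alpha>)"
  interpret prob_space "xi_space \<alpha>" by (rule prob_space_xi_space)
  have "indep_vars (\<lambda>_. ?B) (\<lambda>j x. x j) {2..}"
    unfolding xi_space_def by (intro indep_vars_PiM_components measure_pmf.prob_space_axioms) auto
  then have "indep_vars (\<lambda>_. ?B) (\<lambda>j x. x j) {m<..n}"
    by (rule indep_vars_subset) (use m in auto)
  then have ind: "indep_vars (\<lambda>_. borel) (\<lambda>j x. of_bool (\<not> x j) :: real) {m<..n}"
    by (rule indep_vars_compose2) auto
  have E: "integral\<^sup>L (xi_space \<alpha>) (\<lambda>x. of_bool (\<not> x j)) = 1 - \<alpha>" if "j \<in> {m<..n}" for j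
  proof -
    have j: "j \<in> {2..}" using that m by auto
    have "integral\<^sup>L (xi_space \<alpha>) (\<lambda>x. of_bool (\<not> x j) :: real)
        = integral\<^sup>L (distr (xi_space \<alpha>) ?B (\<lambda>x. x j)) (\<lambda>b. of_bool (\<not> b))"
      unfolding xi_space_def using j by (subst integral_distr) auto
    also have "distr (xi_space \<alpha>) ?B (\<lambda>x. x j) = ?B"
      unfolding xi_space_def by (rule distr_PiM_component[OF _ j]) (rule measure_pmf.prob_space_axioms)
    also have "integral\<^sup>L ?B (\<lambda>b. of_bool (\<not> b)) = 1 - \<alpha>"
      using \<alpha> by simp
    finally show ?thesis .
  qed
  have e: "(\<Sum>j\<in>{m<..n}. integral\<^sup>L (xi_space \<alpha>) (\<lambda>x. of_bool (\<not> x j))) - \<epsilon> * card {m<..n}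
      = (1 - \<alpha> - \<epsilon>) * (real n - real m)"
    using m by (simp add: E of_nat_diff algebra_simps)
  from Hoeffding_01(1)[OF prob_space_axioms _ _ ind _ \<epsilon>] m show ?thesis
    unfolding e by (simp add: of_nat_diff)
qed

text \<open>A uniform choice from \<open>{1..j-1}\<close> exceeds \<open>m\<close> with probability \<open>(j - 1 - m) / (j - 1)\<close>, which is at most
\<open>(n - m) / n\<close> for \<open>j\<close> in the window. For a window that is short compared with \<open>n\<close>, few of its times choose
another time of the window.\<close>
lemma u_space_many_late:
  assumes m: "1 \<le> m" "m < n" and \<epsilon>: "0 \<le> \<epsilon>"
  shows "measure u_space {v \<in> space u_space.
      ((real n - real m) / real n + \<epsilon>) * (real n - real m) \<le> (\<Sum>j\<in>{m<..n}. of_bool (m < v j))} \<le> exp (- 2 * \<epsilon>\<^sup>2 * (real n - real m))"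
proof -
  let ?U = "\<lambda>n::nat. uniform_count_measure {1..n-1}"
  have PU: "prob_space (?U j)" if "j \<in> {2..}" for j
    using that by (intro prob_space_uniform_count_measure) auto
  interpret prob_space u_space by (rule prob_space_u_space)
  have "indep_vars ?U (\<lambda>j v. v j) {2..}"
    unfolding u_space_def by (intro indep_vars_PiM_components PU) auto
  then have "indep_vars ?U (\<lambda>j v. v j) {m<..n}"
    by (rule indep_vars_subset) (use m in auto)
  then have ind: "indep_vars (\<lambda>_. borel) (\<lambda>j v. of_bool (m < v j) :: real) {m<..n}"
    by (rule indep_vars_compose2) (auto simp: measurable_def)
  have E: "integral\<^sup>L u_space (\<lambda>v. of_bool (m < v j)) \<le> (real n - real m) / real n" if "j \<in> {m<..n}" for j
  proof -
    have j: "j \<in> {2..}" using that m by auto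
    have "integral\<^sup>L u_space (\<lambda>v. of_bool (m < v j) :: real)
        = integral\<^sup>L (distr u_space (?U j) (\<lambda>v. v j)) (\<lambda>b. of_bool (m < b))"
      unfolding u_space_def using j by (subst integral_distr) (auto simp: measurable_def[of "?U j"])
    also have "distr u_space (?U j) (\<lambda>v. v j) = ?U j"
      unfolding u_space_def by (rule distr_PiM_component[OF PU j])
    also have "integral\<^sup>L (?U j) (\<lambda>b. of_bool (m < b)) = (real j - 1 - real m) / (real j - 1)"
    proof -
      have "{1..j-1} \<inter> {b. m < b} = {m<..j-1}" using m by auto
      moreover have "card {m<..j-1} = j - 1 - m" by simp
      ultimately show ?thesis
        using that m by (simp add: integral_uniform_count_measure of_bool_def sum.If_cases of_nat_diff)
    qed
    also have "\<dots> \<le> (real n - real m) / real n"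
    proof -
      have "real m / real n \<le> real m / (real j - 1)"
        using that m by (intro divide_left_mono) auto
      then show ?thesis using that m by (simp add: diff_divide_distrib)
    qed
    finally show ?thesis .
  qed
  have "(\<Sum>j\<in>{m<..n}. integral\<^sup>L u_space (\<lambda>v. of_bool (m < v j))) \<le> (\<Sum>j\<in>{m<..n}. (real n - real m) / real n)"
    by (intro sum_mono E)
  then have e: "(\<Sum>j\<in>{m<..n}. integral\<^sup>L u_space (\<lambda>v. of_bool (m < v j))) + \<epsilon> * card {m<..n}
      \<le> ((real n - real m) / real n + \<epsilon>) * (real n - real m)"
    using m by (simp add: of_nat_diff algebra_simps)
  have [measurable]: "(\<lambda>v. \<Sum>j\<in>{m<..n}. of_bool (m < v j) :: real) \<in> borel_measurable u_space"
    using ind by (intro borel_measurable_sum) (auto simp: indep_vars_def)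
  have "measure u_space {v \<in> space u_space.
      ((real n - real m) / real n + \<epsilon>) * (real n - real m) \<le> (\<Sum>j\<in>{m<..n}. of_bool (m < v j))}
    \<le> measure u_space {v \<in> space u_space. (\<Sum>j\<in>{m<..n}. of_bool (m < v j))
        \<ge> (\<Sum>j\<in>{m<..n}. integral\<^sup>L u_space (\<lambda>v. of_bool (m < v j))) + \<epsilon> * card {m<..n}}"
  proof (rule finite_measure_mono)
    show "{v \<in> space u_space. ((real n - real m) / real n + \<epsilon>) * (real n - real m) \<le> (\<Sum>j\<in>{m<..n}. of_bool (m < v j))}
      \<subseteq> {v \<in> space u_space. (\<Sum>j\<in>{m<..n}. of_bool (m < v j))
        \<ge> (\<Sum>j\<in>{m<..n}. integral\<^sup>L u_space (\<lambda>v. of_bool (m < v j))) + \<epsilon> * card {m<..n}}"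
      using order_trans[OF e] by blast
  qed measurable
  also have "\<dots> \<le> exp (- 2 * \<epsilon>\<^sup>2 * (real n - real m))"
    using Hoeffding_01(2)[OF prob_space_axioms _ _ ind _ \<epsilon>] m by (simp add: of_nat_diff)
  finally show ?thesis .
qed

section \<open>Concentration of the canonical walk\<close>

definition canonical_measure :: "'a measure \<Rightarrow> real \<Rightarrow> 'a canonical_space measure" where
  "canonical_measure \<mu> \<alpha> = PiM {1..} (\<lambda>_. \<mu>) \<Otimes>\<^sub>M (xi_space \<alpha> \<Otimes>\<^sub>M u_space)"

lemma prob_space_canonical_measure:
  assumes "prob_space \<mu>"
  shows "prob_space (canonical_measure \<mu> \<alpha>)"
  unfolding canonical_measure_def
  by (intro prob_space_pair prob_space_PiM assms prob_space_xi_space prob_space_u_space)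

lemma u_space_bounds: "v \<in> space u_space \<Longrightarrow> 2 \<le> k \<Longrightarrow> v k \<in> {1..k-1}"
  by (auto simp: u_space_def space_PiM PiE_def Pi_def space_uniform_count_measure)

lemma measurable_xi_space: "2 \<le> k \<Longrightarrow> (\<lambda>x. x k) \<in> xi_space \<alpha> \<rightarrow>\<^sub>M count_space UNIV"
  unfolding xi_space_def
  using measurable_component_singleton[of k "{2..}" "\<lambda>_. measure_pmf (bernoulli_pmf \<alpha>)"] by simp

lemma measurable_u_space: "2 \<le> k \<Longrightarrow> (\<lambda>v. v k) \<in> u_space \<rightarrow>\<^sub>M count_space {1..k-1}"
  unfolding u_space_def
  by (subst measurable_cong_sets[OF refl sets_uniform_count_measure_count_space[symmetric]])
     (rule measurable_component_singleton, simp)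

lemma measurable_canonical_walk_canonical:
  fixes t :: "nat \<Rightarrow> 'a::euclidean_space \<Rightarrow> 'a"
  assumes S: "sets \<mu> = sets borel" and t: "\<And>k. 2 \<le> k \<Longrightarrow> t k \<in> borel \<rightarrow>\<^sub>M borel"
  shows "canonical_walk t n \<in> canonical_measure \<mu> \<alpha> \<rightarrow>\<^sub>M borel"
proof -
  have "(\<lambda>p. canonical_walk t n (fst p, fst (snd p), snd (snd p))) \<in> canonical_measure \<mu> \<alpha> \<rightarrow>\<^sub>M borel"
  proof (rule measurable_canonical_walk(2)[OF t])
    fix k :: nat
    show "(\<lambda>p. fst p k) \<in> canonical_measure \<mu> \<alpha> \<rightarrow>\<^sub>M borel" if "1 \<le> k"
      unfolding canonical_measure_def measurable_cong_sets[OF refl S[symmetric]]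
      by (rule measurable_compose[OF measurable_fst measurable_component_singleton]) (use that in simp)
    show "(\<lambda>p. fst (snd p) k) \<in> canonical_measure \<mu> \<alpha> \<rightarrow>\<^sub>M count_space UNIV" if "2 \<le> k"
      unfolding canonical_measure_def using measurable_xi_space[OF that, measurable] by measurable
    show "(\<lambda>p. snd (snd p) k) \<in> canonical_measure \<mu> \<alpha> \<rightarrow>\<^sub>M count_space {1..k-1}" if "2 \<le> k"
      unfolding canonical_measure_def using measurable_u_space[OF that, measurable] by measurable
  qed
  then show ?thesis by simp
qed

text \<open>From \<open>y\<^sup>d \<le> exp (d y)\<close> with \<open>y = a n / d\<close>; as \<open>n \<ge> 1\<close>, the resulting power \<open>- d\<close> of \<open>n\<close> may be replaced by \<open>- d / 2\<close>.\<close>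
lemma exp_minus_le_powr:
  assumes "a > 0" "n \<ge> (1::nat)" "d > (0::nat)"
  shows "exp (- a * real n) \<le> (real d / a) ^ d * real n powr (- (real d / 2))"
proof -
  define y where "y = a * real n / real d"
  have y: "y > 0" using assms by (simp add: y_def)
  have "y ^ d \<le> exp y ^ d"
    using y exp_ge_add_one_self[of y] by (intro power_mono) linarith+
  also have "\<dots> = exp (a * real n)"
    using assms by (simp add: exp_of_nat_mult[symmetric] y_def)
  finally have "exp (- a * real n) \<le> 1 / y ^ d"
    using y by (simp add: exp_minus divide_simps)
  also have "\<dots> = (real d / a) ^ d * (1 / real n ^ d)"
    using assms by (simp add: y_def field_simps)
  also have "\<dots> \<le> (real d / a) ^ d * real n powr (- (real d / 2))"
  proof (rule mult_left_mono)
    have "1 / real n ^ d = real n powr (- real d)"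
      using assms by (simp add: powr_minus_divide powr_realpow)
    also have "\<dots> \<le> real n powr (- (real d / 2))"
      using assms by (intro powr_mono) auto
    finally show "1 / real n ^ d \<le> real n powr (- (real d / 2))" .
  qed (use assms in auto)
  finally show ?thesis .
qed

text \<open>Put \<open>q = 1 - \<alpha>\<close> and use a window of about \<open>q n / 4\<close> times. Outside an event of exponentially small
probability, the proportion of fresh times in the window is at least \<open>q - q / 4\<close> and the proportion of times
that choose a time of the window is at most \<open>q / 4 + q / 4\<close>. This leaves a proportion \<open>q / 4\<close> of isolated
times, that is, at least \<open>q\<^sup>2 n / 32\<close> of them. The bound for given choices is then integrated over the
choices. The constant is a sum of three: \<open>C1\<close> for the good event, \<open>C2\<close> for the exceptional one and \<open>C3\<close>
for the finitely many \<open>n\<close> below \<open>8 / q\<close>, for which rounding the length of the window matters.\<close>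
lemma canonical_walk_concentration:
  fixes \<mu> :: "'a::euclidean_space measure"
  assumes \<mu>: "prob_space \<mu>" and S: "sets \<mu> = sets borel" and ns: "nonsingular \<mu>"
    and \<alpha>: "0 \<le> \<alpha>" "\<alpha> < 1" and r: "r > 0"
  obtains C where "C > 0"
    "\<And>t n z. \<lbrakk>\<And>k. 2 \<le> k \<Longrightarrow> t k \<in> borel \<rightarrow>\<^sub>M borel; 1 \<le> n\<rbrakk> \<Longrightarrow>
       measure (canonical_measure \<mu> \<alpha>) {p \<in> space (canonical_measure \<mu> \<alpha>). canonical_walk t n p \<in> ball z r}
         \<le> C * real n powr (- (real DIM('a) / 2))"
proof -
  from canonical_walk_ball_le[OF \<mu> S ns r] obtain K where K: "K > 0"
    "\<And>t x v n z. \<lbrakk>\<And>k. 2 \<le> k \<Longrightarrow> t k \<in> borel \<rightarrow>\<^sub>M borel; \<And>k. 2 \<le> k \<Longrightarrow> v k \<in> {1..k-1}; isolated x v n \<noteq> {}\<rbrakk>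
      \<Longrightarrow> measure (PiM {1..} (\<lambda>_. \<mu>)) {\<gamma> \<in> space (PiM {1..} (\<lambda>_. \<mu>)). canonical_walk t n (\<gamma>, x, v) \<in> ball z r}
        \<le> K * real (card (isolated x v n)) powr (- (real DIM('a) / 2))" by blast
  define e where "e = real DIM('a) / 2"
  define q where "q = 1 - \<alpha>"
  define a where "a = q ^ 3 / 64"
  have q: "0 < q" "q \<le> 1" and a: "0 < a" using \<alpha> by (auto simp: q_def a_def)
  have e: "e > 0" by (simp add: e_def)
  define C1 where "C1 = K * (q\<^sup>2 / 32) powr (- e)"
  define C2 where "C2 = 2 * (real DIM('a) / a) ^ DIM('a)"
  define C3 where "C3 = (8 / q) powr e"
  have C: "C1 > 0" "C2 > 0" "C3 > 0" using K q a by (auto simp: C1_def C2_def C3_def)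
  let ?G = "PiM {1::nat..} (\<lambda>_. \<mu>)"
  let ?W = "xi_space \<alpha> \<Otimes>\<^sub>M u_space"
  let ?N = "canonical_measure \<mu> \<alpha>"
  interpret G: prob_space ?G by (rule prob_space_PiM) (rule \<mu>)
  interpret B: prob_space "xi_space \<alpha>" by (rule prob_space_xi_space)
  interpret U: prob_space u_space by (rule prob_space_u_space)
  interpret W: pair_prob_space "xi_space \<alpha>" u_space ..
  interpret N: pair_prob_space ?G ?W ..
  interpret NN: prob_space ?N by (rule prob_space_canonical_measure[OF \<mu>])
  have "measure ?N {p \<in> space ?N. canonical_walk t n p \<in> ball z r} \<le> (C1 + C2 + C3) * real n powr (- e)"
    if t: "\<And>k. 2 \<le> k \<Longrightarrow> t k \<in> borel \<rightarrow>\<^sub>M borel" and n: "1 \<le> n" for t n z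
  proof (cases "real n < 8 / q")
    case True
    have "measure ?N {p \<in> space ?N. canonical_walk t n p \<in> ball z r} \<le> 1"
      unfolding canonical_measure_def by (rule N.prob_le_1)
    also have "1 \<le> (8 / q / real n) powr e"
      using True n q e by (intro ge_one_powr_ge_zero) (auto simp: field_simps)
    also have "\<dots> = C3 * real n powr (- e)"
      using n q powr_divide[of "8 / q" "real n" e] by (simp only: C3_def powr_minus_divide) simp
    also have "\<dots> \<le> (C1 + C2 + C3) * real n powr (- e)"
      using C by (intro mult_right_mono) auto
    finally show ?thesis .
  next
    case False
    then have qn: "8 \<le> q * real n" using q by (simp add: field_simps)
    \<comment> \<open>The length of the window; \<open>q n \<ge> 8\<close> keeps the rounding from losing more than half of it.\<close>
    define k where "k = nat \<lfloor>q * real n / 4\<rfloor>"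
    define m where "m = n - k"
    have k: "real k \<le> q * real n / 4" "q * real n / 8 \<le> real k"
      unfolding k_def using qn by linarith+
    have "q * real n \<le> real n" using q n by (simp add: mult_le_cancel_right1)
    with k qn n have kn: "k < n" "1 \<le> k" by linarith+
    then have m: "1 \<le> m" "m < n" and mk: "real n - real m = real k" by (auto simp: m_def)
    define bad1 where "bad1 = {x \<in> space (xi_space \<alpha>). (\<Sum>j\<in>{m<..n}. of_bool (\<not> x j)) \<le> (1 - \<alpha> - q / 4) * (real n - real m)}"
    define bad2 where "bad2 = {v \<in> space u_space. ((real n - real m) / real n + q / 4) * (real n - real m) \<le> (\<Sum>j\<in>{m<..n}. of_bool (m < v j))}"
    define bad where "bad = bad1 \<times> space u_space \<union> space (xi_space \<alpha>) \<times> bad2"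
    have s1: "(\<lambda>x. \<Sum>j\<in>{m<..n}. of_bool (\<not> x j) :: real) \<in> borel_measurable (xi_space \<alpha>)"
      using m by (intro borel_measurable_sum measurable_compose[OF measurable_xi_space]) auto
    have s2: "(\<lambda>v. \<Sum>j\<in>{m<..n}. of_bool (m < v j) :: real) \<in> borel_measurable u_space"
      using m by (intro borel_measurable_sum measurable_compose[OF measurable_u_space]) auto
    have b1: "bad1 \<in> sets (xi_space \<alpha>)"
      unfolding bad1_def using s1 by measurable
    have b2: "bad2 \<in> sets u_space"
      unfolding bad2_def using s2 by measurable
    have badm: "bad \<in> sets ?W" unfolding bad_def using b1 b2 by auto
    have small: "2 * exp (- 2 * (q / 4)\<^sup>2 * real k) \<le> C2 * real n powr (- e)"
    proof -
      have "a * real n = 2 * (q / 4)\<^sup>2 * (q * real n / 8)"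
        by (simp add: a_def power2_eq_square power3_eq_cube)
      also have "\<dots> \<le> 2 * (q / 4)\<^sup>2 * real k"
        using k by (intro mult_left_mono) auto
      finally have "exp (- 2 * (q / 4)\<^sup>2 * real k) \<le> exp (- a * real n)" by simp
      also have "\<dots> \<le> (real DIM('a) / a) ^ DIM('a) * real n powr (- e)"
        unfolding e_def by (rule exp_minus_le_powr[OF a n]) simp
      finally show ?thesis by (simp add: C2_def)
    qed
    have "measure ?W bad \<le> measure ?W (bad1 \<times> space u_space) + measure ?W (space (xi_space \<alpha>) \<times> bad2)"
      unfolding bad_def using b1 b2 by (intro measure_Un_le) auto
    also have "\<dots> = measure (xi_space \<alpha>) bad1 + measure u_space bad2"
      using b1 b2 by (simp add: measure_def U.emeasure_pair_measure_Times B.emeasure_space_1 U.emeasure_space_1)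
    also have "\<dots> \<le> exp (- 2 * (q / 4)\<^sup>2 * real k) + exp (- 2 * (q / 4)\<^sup>2 * real k)"
      unfolding bad1_def bad2_def mk[symmetric]
      using \<alpha> q m by (intro add_mono xi_space_few_fresh u_space_many_late) auto
    finally have pbad: "measure ?W bad \<le> C2 * real n powr (- e)" using small by simp
    define A where "A = {p \<in> space ?N. canonical_walk t n p \<in> ball z r}"
    have A: "A \<in> sets (?G \<Otimes>\<^sub>M ?W)"
    proof -
      have "canonical_walk t n \<in> ?N \<rightarrow>\<^sub>M borel"
        by (rule measurable_canonical_walk_canonical[OF S t])
      from measurable_sets[OF this, of "ball z r"] show ?thesis
        by (simp add: A_def vimage_def Int_def conj_commute canonical_measure_def)
    qed
    have slice: "emeasure ?G ((\<lambda>\<gamma>. (\<gamma>, y)) -` A) \<le> ennreal (C1 * real n powr (- e)) + indicator bad y"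
      if y: "y \<in> space ?W" for y
    proof (cases "y \<in> bad")
      case True
      have "emeasure ?G ((\<lambda>\<gamma>. (\<gamma>, y)) -` A) \<le> 1" by (rule G.emeasure_le_1)
      also have "1 \<le> ennreal (C1 * real n powr (- e)) + indicator bad y"
        using True by (simp add: add_increasing)
      finally show ?thesis .
    next
      case nb: False
      obtain x v where xv: "y = (x, v)" by (cases y)
      have x: "x \<in> space (xi_space \<alpha>)" and v: "v \<in> space u_space"
        using y by (auto simp: xv space_pair_measure)
      have vk: "v k \<in> {1..k-1}" if "2 \<le> k" for k using u_space_bounds[OF v that] .
      have vless: "\<And>j. 2 \<le> j \<Longrightarrow> v j < j" using vk by force
      define L where "L = real (card (isolated x v n))"
      have ci: "(\<Sum>j\<in>{m<..n}. of_bool (\<not> x j)) - (\<Sum>j\<in>{m<..n}. of_bool (m < v j)) \<le> L"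
        unfolding L_def using m(1) vless by (rule card_isolated_ge)
      have "x \<notin> bad1" "v \<notin> bad2" using nb x v by (auto simp: xv bad_def)
      then have 1: "(1 - \<alpha> - q / 4) * real k < (\<Sum>j\<in>{m<..n}. of_bool (\<not> x j))"
        and 2: "(\<Sum>j\<in>{m<..n}. of_bool (m < v j)) < (real k / real n + q / 4) * real k"
        using x v by (auto simp: bad1_def bad2_def mk)
      have "real k / real n \<le> q / 4" using k(1) n by (simp add: field_simps)
      then have "(real k / real n + q / 4) * real k \<le> (q / 4 + q / 4) * real k"
        by (intro mult_right_mono) (linarith, simp)
      then have "(1 - \<alpha> - q / 4) * real k - (q / 4 + q / 4) * real k < L"
        using 1 2 ci by linarith
      moreover have "(1 - \<alpha> - q / 4) * real k - (q / 4 + q / 4) * real k = q / 4 * real k"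
        by (simp add: q_def field_simps)
      moreover have "q\<^sup>2 / 32 * real n = q / 4 * (q * real n / 8)" by (simp add: power2_eq_square)
      moreover have "q / 4 * (q * real n / 8) \<le> q / 4 * real k" using q k by (intro mult_left_mono) auto
      ultimately have L: "q\<^sup>2 / 32 * real n \<le> L" by linarith
      moreover have "0 < q\<^sup>2 / 32 * real n" using q n by simp
      ultimately have "isolated x v n \<noteq> {}" unfolding L_def by auto
      with t vk have "measure ?G {\<gamma> \<in> space ?G. canonical_walk t n (\<gamma>, x, v) \<in> ball z r} \<le> K * L powr (- e)"
        unfolding L_def e_def by (intro K(2))
      also have "\<dots> \<le> K * (q\<^sup>2 / 32 * real n) powr (- e)"
        using K L e \<open>0 < q\<^sup>2 / 32 * real n\<close> by (intro mult_left_mono powr_mono2') auto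
      also have "\<dots> = C1 * real n powr (- e)"
        using q n powr_mult[of "q\<^sup>2 / 32" "real n" "- e"] unfolding C1_def by simp
      finally have "emeasure ?G {\<gamma> \<in> space ?G. canonical_walk t n (\<gamma>, x, v) \<in> ball z r} \<le> ennreal (C1 * real n powr (- e))"
        unfolding G.emeasure_eq_measure by (rule ennreal_leI)
      moreover have "(\<lambda>\<gamma>. (\<gamma>, y)) -` A = {\<gamma> \<in> space ?G. canonical_walk t n (\<gamma>, x, v) \<in> ball z r}"
        using x v by (auto simp: A_def canonical_measure_def space_pair_measure xv)
      ultimately show ?thesis by (simp add: add_increasing2)
    qed
    have "emeasure ?N A = (\<integral>\<^sup>+y. emeasure ?G ((\<lambda>\<gamma>. (\<gamma>, y)) -` A) \<partial>?W)"
      unfolding canonical_measure_def by (rule N.emeasure_pair_measure_alt2[OF A])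
    also have "\<dots> \<le> (\<integral>\<^sup>+y. ennreal (C1 * real n powr (- e)) + indicator bad y \<partial>?W)"
      by (intro nn_integral_mono slice)
    also have "\<dots> = ennreal (C1 * real n powr (- e)) + emeasure ?W bad"
      using badm by (subst nn_integral_add) (auto simp: W.emeasure_space_1)
    also have "\<dots> \<le> ennreal (C1 * real n powr (- e)) + ennreal (C2 * real n powr (- e))"
      using pbad by (intro add_left_mono) (simp add: W.emeasure_eq_measure ennreal_leI)
    also have "\<dots> = ennreal ((C1 + C2) * real n powr (- e))"
      using C by (simp add: ennreal_plus[symmetric] distrib_right del: ennreal_plus)
    finally have "measure ?N A \<le> (C1 + C2) * real n powr (- e)"
      using C by (simp add: NN.emeasure_eq_measure)
    also have "\<dots> \<le> (C1 + C2 + C3) * real n powr (- e)"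
      using C by (intro mult_right_mono) auto
    finally show ?thesis by (simp only: A_def)
  qed
  then show thesis
    using C by (intro that[of "C1 + C2 + C3"]) (auto simp: e_def)
qed

section \<open>The canonical space as a generalized walk\<close>

text \<open>The preimages of measurable sets of paths form a \<open>\<sigma>\<close>-algebra that contains the generators. Conversely,
the path map is measurable for the generated \<open>\<sigma>\<close>-algebra, because all its coordinates are.\<close>
lemma process_sigma_eq_vimage:
  assumes X: "X \<in> M \<rightarrow>\<^sub>M PiM I K" and Y: "\<And>i \<omega>. i \<in> I \<Longrightarrow> \<omega> \<in> space M \<Longrightarrow> Y i \<omega> = X \<omega> i"
  shows "process_sigma M I K Y = {X -` A \<inter> space M |A. A \<in> sets (PiM I K)}"
proof
  let ?V = "vimage_algebra (space M) X (PiM I K)"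
  have V: "sets ?V = {X -` A \<inter> space M |A. A \<in> sets (PiM I K)}"
    using measurable_space[OF X] by (intro sets_vimage_algebra2) auto
  show "process_sigma M I K Y \<subseteq> {X -` A \<inter> space M |A. A \<in> sets (PiM I K)}"
    unfolding process_sigma_def V[symmetric]
  proof (rule sets.sigma_sets_subset[of _ ?V, simplified])
    show "(\<Union>n\<in>I. {Y n -` B \<inter> space M |B. B \<in> sets (K n)}) \<subseteq> sets ?V"
    proof safe
      fix n B assume n: "n \<in> I" and B: "B \<in> sets (K n)"
      have "Y n -` B \<inter> space M = X -` ((\<lambda>f. f n) -` B \<inter> space (PiM I K)) \<inter> space M"
        using Y[OF n] measurable_space[OF X] by auto
      moreover have "(\<lambda>f. f n) -` B \<inter> space (PiM I K) \<in> sets (PiM I K)"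
        using n B by measurable
      ultimately show "Y n -` B \<inter> space M \<in> sets ?V" unfolding V by blast
    qed
  qed
  let ?P = "sigma (space M) (\<Union>n\<in>I. {Y n -` B \<inter> space M |B. B \<in> sets (K n)})"
  have P: "sets ?P = process_sigma M I K Y" "space ?P = space M"
    unfolding process_sigma_def by (auto intro!: sets_measure_of space_measure_of)
  have "(\<lambda>\<omega>. \<lambda>i\<in>I. Y i \<omega>) \<in> ?P \<rightarrow>\<^sub>M PiM I K"
  proof (rule measurable_restrict)
    fix i assume i: "i \<in> I"
    show "Y i \<in> ?P \<rightarrow>\<^sub>M K i"
    proof (rule measurableI)
      show "Y i \<omega> \<in> space (K i)" if "\<omega> \<in> space ?P" for \<omega>
        using that Y[OF i] measurable_space[OF X] i unfolding P by (auto simp: space_PiM)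
      show "Y i -` B \<inter> space ?P \<in> sets ?P" if "B \<in> sets (K i)" for B
        unfolding P process_sigma_def using that i by (intro sigma_sets.Basic) auto
    qed
  qed
  moreover have "(\<lambda>i\<in>I. Y i \<omega>) = X \<omega>" if "\<omega> \<in> space M" for \<omega>
    using Y that measurable_space[OF X that] by (intro ext) (auto simp: space_PiM PiE_def extensional_def)
  ultimately have X': "X \<in> ?P \<rightarrow>\<^sub>M PiM I K"
    using measurable_cong[of ?P "\<lambda>\<omega>. \<lambda>i\<in>I. Y i \<omega>" X] P(2) by simp
  show "{X -` A \<inter> space M |A. A \<in> sets (PiM I K)} \<subseteq> process_sigma M I K Y"
    unfolding P(1)[symmetric] using measurable_sets[OF X'] P(2) by auto
qed

text \<open>A form of independence for variables with values in different types, like the ingredients of the walk: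
disjoint groups of independent families of events generate independent \<open>\<sigma>\<close>-algebras, and the joint law factorises on
rectangles.\<close>
lemma (in prob_space) distr_Pair_if_indep_sets:
  assumes E: "indep_sets E J" "A \<union> B \<subseteq> J" "A \<inter> B = {}" and st: "\<And>i. i \<in> J \<Longrightarrow> Int_stable (E i)"
    and X: "X \<in> sigma (space M) (\<Union>i\<in>A. E i) \<rightarrow>\<^sub>M S" and Y: "Y \<in> sigma (space M) (\<Union>i\<in>B. E i) \<rightarrow>\<^sub>M T"
  shows "distr M S X \<Otimes>\<^sub>M distr M T Y = distr M (S \<Otimes>\<^sub>M T) (\<lambda>\<omega>. (X \<omega>, Y \<omega>))"
proof -
  have ev: "E i \<subseteq> events" if "i \<in> J" for i using E(1) that by (auto simp: indep_sets_def)
  have sub: "sets (sigma (space M) (\<Union>i\<in>C. E i)) = sigma_sets (space M) (\<Union>i\<in>C. E i)"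
      "sigma_sets (space M) (\<Union>i\<in>C. E i) \<subseteq> events" if "C \<subseteq> J" for C
  proof -
    have "(\<Union>i\<in>C. E i) \<subseteq> events" using ev that by auto
    then show "sigma_sets (space M) (\<Union>i\<in>C. E i) \<subseteq> events" by (rule sets.sigma_sets_subset)
    show "sets (sigma (space M) (\<Union>i\<in>C. E i)) = sigma_sets (space M) (\<Union>i\<in>C. E i)"
      using \<open>(\<Union>i\<in>C. E i) \<subseteq> events\<close> sets.space_closed[of M] by (intro sets_measure_of) auto
  qed
  have AB: "A \<subseteq> J" "B \<subseteq> J" using E by auto
  have vim: "{Z -` D \<inter> space M |D. D \<in> sets N} \<subseteq> sigma_sets (space M) (\<Union>i\<in>C. E i)"
    if "Z \<in> sigma (space M) (\<Union>i\<in>C. E i) \<rightarrow>\<^sub>M N" "C \<subseteq> J" for Z C and N :: "'z measure"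
    using measurable_sets[OF that(1)] unfolding sub(1)[OF that(2)] by (auto simp: space_measure_of_conv)
  have "indep_sets (\<lambda>j. sigma_sets (space M) (\<Union>i\<in>case_bool A B j. E i)) UNIV"
  proof (rule indep_sets_collect_sigma)
    show "indep_sets E (\<Union>j\<in>UNIV. case_bool A B j)"
      using E(2) by (intro indep_sets_mono_index[OF _ E(1)]) (auto split: bool.splits)
    show "Int_stable (E i)" if "i \<in> case_bool A B j" for i j
      using that AB by (intro st) (auto split: bool.splits)
    show "disjoint_family_on (case_bool A B) UNIV"
      using E(3) by (auto simp: disjoint_family_on_def split: bool.splits)
  qed
  then have ind: "indep_set (sigma_sets (space M) (\<Union>i\<in>A. E i)) (sigma_sets (space M) (\<Union>i\<in>B. E i))"
    unfolding indep_set_def by (rule indep_sets_mono_sets) (auto split: bool.splits)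
  have rv: "random_variable N Z" if "Z \<in> sigma (space M) (\<Union>i\<in>C. E i) \<rightarrow>\<^sub>M N" "C \<subseteq> J" for Z C and N :: "'z measure"
    using vim[OF that] sub(2)[OF that(2)] measurable_space[OF that(1)]
    by (intro measurableI) (auto simp: space_measure_of_conv)
  note rX = rv[OF X AB(1)] and rY = rv[OF Y AB(2)]
  show ?thesis
  proof (rule pair_measure_eqI)
    show "sigma_finite_measure (distr M S X)" "sigma_finite_measure (distr M T Y)"
      using prob_space_distr[OF rX] prob_space_distr[OF rY] by (auto intro: prob_space_imp_sigma_finite)
    show "sets (distr M S X \<Otimes>\<^sub>M distr M T Y) = sets (distr M (S \<Otimes>\<^sub>M T) (\<lambda>\<omega>. (X \<omega>, Y \<omega>)))"
      by (simp cong: sets_pair_measure_cong)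
    fix C D assume "C \<in> sets (distr M S X)" "D \<in> sets (distr M T Y)"
    then have C: "C \<in> sets S" and D: "D \<in> sets T" by auto
    have "X -` C \<inter> space M \<in> sigma_sets (space M) (\<Union>i\<in>A. E i)" "Y -` D \<inter> space M \<in> sigma_sets (space M) (\<Union>i\<in>B. E i)"
      using vim[OF X AB(1)] vim[OF Y AB(2)] C D by auto
    then have "prob ((X -` C \<inter> space M) \<inter> (Y -` D \<inter> space M)) = prob (X -` C \<inter> space M) * prob (Y -` D \<inter> space M)"
      by (rule indep_setD[OF ind])
    moreover have "(\<lambda>\<omega>. (X \<omega>, Y \<omega>)) -` (C \<times> D) \<inter> space M = (X -` C \<inter> space M) \<inter> (Y -` D \<inter> space M)"
      by auto
    ultimately show "emeasure (distr M S X) C * emeasure (distr M T Y) D = emeasure (distr M (S \<Otimes>\<^sub>M T) (\<lambda>\<omega>. (X \<omega>, Y \<omega>))) (C \<times> D)"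
      using C D rX rY by (simp add: emeasure_distr measurable_Pair emeasure_eq_measure ennreal_mult)
  qed
qed

lemma measure_pair_Times:
  assumes "prob_space N" "A \<in> sets M" "B \<in> sets N"
  shows "measure (M \<Otimes>\<^sub>M N) (A \<times> B) = measure M A * measure N B"
proof -
  interpret prob_space N by fact
  show ?thesis using assms by (simp add: measure_def emeasure_pair_measure_Times enn2real_mult)
qed

lemma distr_pair_fst:
  assumes "prob_space N"
  shows "distr (M \<Otimes>\<^sub>M N) M fst = M"
proof (rule measure_eqI)
  interpret prob_space N by fact
  fix A assume "A \<in> sets (distr (M \<Otimes>\<^sub>M N) M fst)"
  then have A: "A \<in> sets M" by simp
  then have "fst -` A \<inter> space (M \<Otimes>\<^sub>M N) = A \<times> space N"
    using sets.sets_into_space[OF A] by (auto simp: space_pair_measure)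
  then show "emeasure (distr (M \<Otimes>\<^sub>M N) M fst) A = emeasure M A"
    using A by (simp add: emeasure_distr emeasure_pair_measure_Times emeasure_space_1)
qed simp

lemma distr_pair_snd:
  assumes "prob_space M" "prob_space N"
  shows "distr (M \<Otimes>\<^sub>M N) N snd = N"
proof (rule measure_eqI)
  interpret M: prob_space M by fact
  interpret N: prob_space N by fact
  fix A assume "A \<in> sets (distr (M \<Otimes>\<^sub>M N) N snd)"
  then have A: "A \<in> sets N" by simp
  then have "snd -` A \<inter> space (M \<Otimes>\<^sub>M N) = space M \<times> A"
    using sets.sets_into_space[OF A] by (auto simp: space_pair_measure)
  then show "emeasure (distr (M \<Otimes>\<^sub>M N) N snd) A = emeasure N A"
    using A by (simp add: emeasure_distr N.emeasure_pair_measure_Times M.emeasure_space_1)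
qed simp

lemma sets_xi_space: "sets (xi_space \<alpha>) = sets (PiM {2..} (\<lambda>_. count_space UNIV))"
  unfolding xi_space_def by (intro sets_PiM_cong) auto

lemma sets_u_space: "sets u_space = sets (PiM {2..} (\<lambda>n. count_space {1..n-1}))"
  unfolding u_space_def by (intro sets_PiM_cong sets_uniform_count_measure_count_space refl)

text \<open>Transformations that are not random carry no information, so the trivial \<open>\<sigma>\<close>-algebra can carry them. For
the four families, independence amounts to the product formula on boxes, because the events of each family are
preimages of measurable sets of paths.\<close>
lemma generalized_srrw_canonical:
  fixes \<mu> :: "'a::euclidean_space measure"
  assumes \<mu>: "prob_space \<mu>" and S: "sets \<mu> = sets borel" and \<alpha>: "0 \<le> \<alpha>" "\<alpha> \<le> 1"
    and t: "\<And>k. 2 \<le> k \<Longrightarrow> t k \<in> borel \<rightarrow>\<^sub>M borel"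
  shows "generalized_srrw (canonical_measure \<mu> \<alpha>) \<mu> \<alpha> (sigma (space (canonical_measure \<mu> \<alpha>)) {})
    (\<lambda>k p. fst p k) (\<lambda>k p. fst (snd p) k) (\<lambda>k p. snd (snd p) k) (\<lambda>k _. t k)"
proof -
  let ?G = "PiM {1::nat..} (\<lambda>_. \<mu>)" and ?B = "xi_space \<alpha>" and ?U = u_space
  let ?N = "canonical_measure \<mu> \<alpha>"
  let ?F = "sigma (space ?N) {}"
  note N_def = canonical_measure_def
  have G: "prob_space ?G" by (rule prob_space_PiM) (rule \<mu>)
  have W: "prob_space (?B \<Otimes>\<^sub>M ?U)" by (intro prob_space_pair prob_space_xi_space prob_space_u_space)
  interpret N: prob_space ?N by (rule prob_space_canonical_measure[OF \<mu>])
  have m: "fst \<in> ?N \<rightarrow>\<^sub>M ?G" "(\<lambda>p. fst (snd p)) \<in> ?N \<rightarrow>\<^sub>M ?B" "(\<lambda>p. snd (snd p)) \<in> ?N \<rightarrow>\<^sub>M ?U"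
    unfolding N_def by measurable
  have d1: "distr ?N ?G fst = ?G"
    unfolding N_def by (rule distr_pair_fst[OF W])
  have d2: "distr ?N (?B \<Otimes>\<^sub>M ?U) snd = ?B \<Otimes>\<^sub>M ?U"
    unfolding N_def by (rule distr_pair_snd[OF G W])
  have sm: "snd \<in> ?N \<rightarrow>\<^sub>M ?B \<Otimes>\<^sub>M ?U" unfolding N_def by measurable
  have d3: "distr ?N ?B (\<lambda>p. fst (snd p)) = ?B"
    using distr_distr[OF measurable_fst sm] d2 distr_pair_fst[OF prob_space_u_space, of ?B]
    by (simp add: o_def)
  have d4: "distr ?N ?U (\<lambda>p. snd (snd p)) = ?U"
    using distr_distr[OF measurable_snd sm] d2 distr_pair_snd[OF prob_space_xi_space prob_space_u_space, of \<alpha>]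
    by (simp add: o_def)
  have PU: "prob_space (uniform_count_measure {1..n-1})" if "n \<in> {2..}" for n :: nat
    using that by (intro prob_space_uniform_count_measure) auto
  note PB = measure_pmf.prob_space_axioms
  have space_F: "space ?F = space ?N" "sets ?F = {{}, space ?N}"
    by (auto simp: space_measure_of_conv sigma_sets_empty_eq)
  let ?E = "\<lambda>i::nat. [process_sigma ?N {1..} (\<lambda>_. borel) (\<lambda>k p. fst p k),
      process_sigma ?N {2..} (\<lambda>_. count_space UNIV) (\<lambda>k p. fst (snd p) k),
      process_sigma ?N {2..} (\<lambda>n. count_space {1..n-1}) (\<lambda>k p. snd (snd p) k), sets ?F] ! i"
  have sG: "sets ?G = sets (PiM {1..} (\<lambda>_. borel))" by (intro sets_PiM_cong) (auto simp: S)
  have E0: "?E 0 = {fst -` A \<inter> space ?N |A. A \<in> sets ?G}"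
    using process_sigma_eq_vimage[of fst ?N "{1..}" "\<lambda>_. borel" "\<lambda>k p. fst p k"] m(1)
    unfolding sG measurable_cong_sets[OF refl sG] by simp
  have E1: "?E 1 = {(\<lambda>p. fst (snd p)) -` A \<inter> space ?N |A. A \<in> sets ?B}"
    using process_sigma_eq_vimage[of "\<lambda>p. fst (snd p)" ?N "{2..}" "\<lambda>_. count_space UNIV" "\<lambda>k p. fst (snd p) k"] m(2)
    unfolding sets_xi_space measurable_cong_sets[OF refl sets_xi_space] by simp
  have E2: "?E 2 = {(\<lambda>p. snd (snd p)) -` A \<inter> space ?N |A. A \<in> sets ?U}"
    using process_sigma_eq_vimage[of "\<lambda>p. snd (snd p)" ?N "{2..}" "\<lambda>n. count_space {1..n-1}" "\<lambda>k p. snd (snd p) k"] m(3)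
    unfolding sets_u_space measurable_cong_sets[OF refl sets_u_space] by simp
  have E3: "?E 3 = {{}, space ?N}" using space_F by simp
  have i4: "i \<in> {..<4} \<longleftrightarrow> i = 0 \<or> i = 1 \<or> i = 2 \<or> i = (3::nat)" for i by auto
  have ind: "N.indep_sets ?E {..<4}"
  proof (subst N.indep_sets_finite)
    show "?E i \<subseteq> sets ?N" if "i \<in> {..<4}" for i
      using that measurable_sets[OF m(1)] measurable_sets[OF m(2)] measurable_sets[OF m(3)]
      unfolding i4 by (elim disjE) (simp_all only: E0 E1 E2 E3, auto)
    show "space ?N \<in> ?E i" if "i \<in> {..<4}" for i
    proof -
      have "space ?N = fst -` space ?G \<inter> space ?N" "space ?N = (\<lambda>p. fst (snd p)) -` space ?B \<inter> space ?N"
        "space ?N = (\<lambda>p. snd (snd p)) -` space ?U \<inter> space ?N"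
        using measurable_space[OF m(1)] measurable_space[OF m(2)] measurable_space[OF m(3)] by auto
      then show ?thesis
        using that unfolding i4 by (elim disjE) (simp_all only: E0 E1 E2 E3, blast+)
    qed
    show "\<forall>A\<in>Pi {..<4} ?E. N.prob (\<Inter>j\<in>{..<4}. A j) = (\<Prod>j\<in>{..<4}. N.prob (A j))"
    proof
      fix A assume A: "A \<in> Pi {..<4} ?E"
      have A': "A 0 \<in> ?E 0" "A 1 \<in> ?E 1" "A 2 \<in> ?E 2" "A 3 \<in> ?E 3"
        using A by (auto simp only: Pi_iff i4)
      from A'(1) obtain A0 where A0: "A 0 = fst -` A0 \<inter> space ?N" "A0 \<in> sets ?G"
        unfolding E0 by blast
      from A'(2) obtain A1 where A1: "A 1 = (\<lambda>p. fst (snd p)) -` A1 \<inter> space ?N" "A1 \<in> sets ?B"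
        unfolding E1 by blast
      from A'(3) obtain A2 where A2: "A 2 = (\<lambda>p. snd (snd p)) -` A2 \<inter> space ?N" "A2 \<in> sets ?U"
        unfolding E2 by blast
      have A3: "A 3 = {} \<or> A 3 = space ?N" using A'(4) unfolding E3 by blast
      have p0: "N.prob (A 0) = measure ?G A0"
        using measure_distr[OF m(1) A0(2)] unfolding d1 A0(1) by simp
      have p1: "N.prob (A 1) = measure ?B A1"
        using measure_distr[OF m(2) A1(2)] unfolding d3 A1(1) by simp
      have p2: "N.prob (A 2) = measure ?U A2"
        using measure_distr[OF m(3) A2(2)] unfolding d4 A2(1) by simp
      have box: "A 0 \<inter> A 1 \<inter> A 2 = A0 \<times> (A1 \<times> A2)"
        unfolding A0(1) A1(1) A2(1)
        using sets.sets_into_space[OF A0(2)] sets.sets_into_space[OF A1(2)] sets.sets_into_space[OF A2(2)]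
        by (auto simp: N_def space_pair_measure)
      have "N.prob (A0 \<times> (A1 \<times> A2)) = measure ?G A0 * (measure ?B A1 * measure ?U A2)"
        unfolding N_def using A0(2) A1(2) A2(2) by (simp add: measure_pair_Times W prob_space_u_space)
      then have p: "N.prob (A 0 \<inter> A 1 \<inter> A 2) = N.prob (A 0) * (N.prob (A 1) * N.prob (A 2))"
        by (simp only: box p0 p1 p2)
      have s4: "{..<4::nat} = {0, 1, 2, 3}" by auto
      have i: "(\<Inter>j\<in>{..<4}. A j) = A 0 \<inter> A 1 \<inter> A 2 \<inter> A 3"
        unfolding s4 by auto
      from s4 have pr: "(\<Prod>j\<in>{..<4}. N.prob (A j)) = N.prob (A 0) * (N.prob (A 1) * (N.prob (A 2) * N.prob (A 3)))"
        by simp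
      have "A 0 \<inter> A 1 \<inter> A 2 \<inter> space ?N = A 0 \<inter> A 1 \<inter> A 2" unfolding A0(1) by auto
      with A3 p show "N.prob (\<Inter>j\<in>{..<4}. A j) = (\<Prod>j\<in>{..<4}. N.prob (A j))"
        unfolding i pr by (elim disjE) (simp_all add: N.prob_space)
    qed
  qed (simp_all add: lessThan_empty_iff)
  show ?thesis
  proof (unfold_locales)
    show "0 \<le> \<alpha>" "\<alpha> \<le> 1" by fact+
    have "N.indep_vars (\<lambda>_. \<mu>) (\<lambda>k p. fst p k) {1..}"
      using m(1) d1 \<mu> by (intro N.indep_vars_if_distr_eq_PiM) auto
    then show "N.indep_vars (\<lambda>_. borel) (\<lambda>k p. fst p k) {1..}"
      by (rule indep_vars_sets_cong) (use S N.prob_space_axioms in auto)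
    show "distr ?N borel (\<lambda>p. fst p n) = \<mu>" if "1 \<le> n" for n
    proof -
      have "distr ?N borel (\<lambda>p. fst p n) = distr ?N \<mu> (\<lambda>p. fst p n)"
        by (intro distr_cong) (auto simp: S)
      also have "\<dots> = \<mu>"
        using m(1) d1 \<mu> that by (intro N.distr_component_if_distr_eq_PiM[of "{1..}" "\<lambda>_. \<mu>"]) auto
      finally show ?thesis .
    qed
    have "N.indep_vars (\<lambda>_. measure_pmf (bernoulli_pmf \<alpha>)) (\<lambda>k p. fst (snd p) k) {2..}"
      using m(2) d3 PB unfolding xi_space_def by (intro N.indep_vars_if_distr_eq_PiM) auto
    then show "N.indep_vars (\<lambda>_. count_space UNIV) (\<lambda>k p. fst (snd p) k) {2..}"
      by (rule indep_vars_sets_cong) (use N.prob_space_axioms in auto)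
    show "distr ?N (count_space UNIV) (\<lambda>p. fst (snd p) n) = measure_pmf (bernoulli_pmf \<alpha>)" if "2 \<le> n" for n
    proof -
      have "distr ?N (count_space UNIV) (\<lambda>p. fst (snd p) n) = distr ?N (measure_pmf (bernoulli_pmf \<alpha>)) (\<lambda>p. fst (snd p) n)"
        by (intro distr_cong) auto
      also have "\<dots> = measure_pmf (bernoulli_pmf \<alpha>)"
        using m(2) d3 PB that unfolding xi_space_def
        by (intro N.distr_component_if_distr_eq_PiM[of "{2..}" "\<lambda>_. measure_pmf (bernoulli_pmf \<alpha>)"]) auto
      finally show ?thesis .
    qed
    have "N.indep_vars (\<lambda>n. uniform_count_measure {1..n-1}) (\<lambda>k p. snd (snd p) k) {2..}"
      using m(3) d4 PU unfolding u_space_def by (intro N.indep_vars_if_distr_eq_PiM) auto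
    then show "N.indep_vars (\<lambda>n. count_space {1..n-1}) (\<lambda>k p. snd (snd p) k) {2..}"
      by (rule indep_vars_sets_cong) (use N.prob_space_axioms sets_uniform_count_measure_count_space in auto)
    show "distr ?N (count_space {1..n-1}) (\<lambda>p. snd (snd p) n) = uniform_count_measure {1..n-1}" if "2 \<le> n" for n
    proof -
      have "distr ?N (count_space {1..n-1}) (\<lambda>p. snd (snd p) n) = distr ?N (uniform_count_measure {1..n-1}) (\<lambda>p. snd (snd p) n)"
        by (intro distr_cong) (auto simp: sets_uniform_count_measure)
      also have "\<dots> = uniform_count_measure {1..n-1}"
        using m(3) d4 PU that unfolding u_space_def
        by (intro N.distr_component_if_distr_eq_PiM[of "{2..}" "\<lambda>n. uniform_count_measure {1..n-1}"]) auto
      finally show ?thesis .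
    qed
    show "subalgebra ?N ?F" using space_F by (auto simp: subalgebra_def)
    show "(\<lambda>(\<omega>, x). t n x) \<in> ?F \<Otimes>\<^sub>M borel \<rightarrow>\<^sub>M borel" if "2 \<le> n" for n
      using t[OF that] by measurable
    show "N.indep_sets ?E {..<4}" by (rule ind)
  qed
qed

section \<open>General walks as mixtures of canonical walks\<close>

context generalized_srrw
begin

lemma sets_mu: "sets \<mu> = sets borel"
  using g_distr[of 1] by (metis order_refl sets_distr)

lemma prob_space_mu: "prob_space \<mu>"
proof -
  have "random_variable borel (g 1)" using g_indep by (auto simp: indep_vars_def)
  then show ?thesis using g_distr[of 1] prob_space_distr[of "g 1" borel] by simp
qed

lemma measurable_drivers:
  shows "1 \<le> n \<Longrightarrow> g n \<in> M \<rightarrow>\<^sub>M borel" "2 \<le> n \<Longrightarrow> \<xi> n \<in> M \<rightarrow>\<^sub>M count_space UNIV"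
    "2 \<le> n \<Longrightarrow> u n \<in> M \<rightarrow>\<^sub>M count_space {1..n-1}"
  using g_indep xi_indep u_indep by (auto simp: indep_vars_def)

lemma measurable_id_F: "(\<lambda>\<omega>. \<omega>) \<in> M \<rightarrow>\<^sub>M F"
proof (rule measurableI)
  have F: "space F = space M" "sets F \<subseteq> sets M" using F_subalgebra by (auto simp: subalgebra_def)
  then show "\<omega> \<in> space F" if "\<omega> \<in> space M" for \<omega> using that by simp
  show "(\<lambda>\<omega>. \<omega>) -` A \<inter> space M \<in> sets M" if "A \<in> sets F" for A
    using that F sets.sets_into_space[OF that] by (auto simp: Int_absorb2)
qed

text \<open>At the times that the model does not use, the sequences are arbitrary functions; the restriction turns
the paths into elements of the product spaces.\<close>
definition driver :: "'w \<Rightarrow> 'a canonical_space" where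
  "driver \<omega> = (\<lambda>n\<in>{1..}. g n \<omega>, \<lambda>n\<in>{2..}. \<xi> n \<omega>, \<lambda>n\<in>{2..}. u n \<omega>)"

text \<open>The form of independence that Fubini's theorem needs. The factorisation of joint laws is applied three
times: it separates the uniform from the Bernoulli variables, then the steps from both, and finally \<open>F\<close>
from all three.\<close>
lemma distr_driver:
  "distr M (F \<Otimes>\<^sub>M canonical_measure \<mu> \<alpha>) (\<lambda>\<omega>. (\<omega>, driver \<omega>)) = distr M F (\<lambda>\<omega>. \<omega>) \<Otimes>\<^sub>M canonical_measure \<mu> \<alpha>"
  and measurable_driver: "driver \<in> M \<rightarrow>\<^sub>M canonical_measure \<mu> \<alpha>"
proof -
  let ?G = "PiM {1::nat..} (\<lambda>_. borel :: 'a measure)" and ?B = "PiM {2::nat..} (\<lambda>_. count_space (UNIV :: bool set))"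
    and ?U = "PiM {2::nat..} (\<lambda>n. count_space {1..n-1})"
  let ?E = "\<lambda>i::nat. [process_sigma M {1..} (\<lambda>_. borel) g, process_sigma M {2..} (\<lambda>_. count_space UNIV) \<xi>,
                process_sigma M {2..} (\<lambda>n. count_space {1..n-1}) u, sets F] ! i"
  define X where "X \<omega> = (\<lambda>n\<in>{1..}. g n \<omega>)" for \<omega>
  define Y where "Y \<omega> = (\<lambda>n\<in>{2..}. \<xi> n \<omega>)" for \<omega>
  define Z where "Z \<omega> = (\<lambda>n\<in>{2..}. u n \<omega>)" for \<omega>
  have mX: "X \<in> M \<rightarrow>\<^sub>M ?G" unfolding X_def by (intro measurable_restrict measurable_drivers) auto
  have mY: "Y \<in> M \<rightarrow>\<^sub>M ?B" unfolding Y_def by (intro measurable_restrict measurable_drivers) auto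
  have mZ: "Z \<in> M \<rightarrow>\<^sub>M ?U" unfolding Z_def by (intro measurable_restrict measurable_drivers) auto
  have F: "space F = space M" "sets F \<subseteq> sets M" using F_subalgebra by (auto simp: subalgebra_def)
  have i4: "i \<in> {..<4} \<longleftrightarrow> i = 0 \<or> i = 1 \<or> i = 2 \<or> i = (3::nat)" for i by auto
  have E0: "?E 0 = {X -` A \<inter> space M |A. A \<in> sets ?G}"
    using process_sigma_eq_vimage[OF mX, of g] by (simp add: X_def)
  have E1: "?E 1 = {Y -` A \<inter> space M |A. A \<in> sets ?B}"
    using process_sigma_eq_vimage[OF mY, of \<xi>] by (simp add: Y_def)
  have E2: "?E 2 = {Z -` A \<inter> space M |A. A \<in> sets ?U}"
    using process_sigma_eq_vimage[OF mZ, of u] by (simp add: Z_def)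
  have E3: "?E 3 = sets F" by simp
  have st: "Int_stable (?E i)" if "i \<in> {..<4}" for i
  proof -
    have vim: "{h -` A \<inter> space M |A. A \<in> sets N} = sets (vimage_algebra (space M) h N)"
      if "h \<in> M \<rightarrow>\<^sub>M N" for h and N :: "'z measure"
      using measurable_space[OF that] by (intro sets_vimage_algebra2[symmetric]) auto
    show ?thesis
      using that unfolding i4
      by (elim disjE) (simp_all only: E0 E1 E2 E3 vim[OF mX] vim[OF mY] vim[OF mZ] sets.Int_stable)
  qed
  have EP: "(\<Union>i\<in>C. ?E i) \<subseteq> Pow (space M)" if "C \<subseteq> {..<4}" for C
    using that sequences_indep sets.space_closed[of M] by (auto simp: indep_sets_def subset_eq)
  have mE: "h \<in> sigma (space M) (\<Union>i\<in>C. ?E i) \<rightarrow>\<^sub>M N"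
    if "h \<in> space M \<rightarrow> space N" "\<And>A. A \<in> sets N \<Longrightarrow> h -` A \<inter> space M \<in> ?E i" "i \<in> C" "C \<subseteq> {..<4}" for h C i and N :: "'z measure"
  proof (rule measurableI)
    have sp: "space (sigma (space M) (\<Union>i\<in>C. ?E i)) = space M" by (simp add: space_measure_of_conv)
    show "h x \<in> space N" if "x \<in> space (sigma (space M) (\<Union>i\<in>C. ?E i))" for x
      using that \<open>h \<in> space M \<rightarrow> space N\<close> unfolding sp by auto
    show "h -` A \<inter> space (sigma (space M) (\<Union>i\<in>C. ?E i)) \<in> sets (sigma (space M) (\<Union>i\<in>C. ?E i))" if "A \<in> sets N" for A
      unfolding sp sets_measure_of[OF EP[OF \<open>C \<subseteq> {..<4}\<close>]]
      by (rule sigma_sets.Basic) (use \<open>\<And>A. A \<in> sets N \<Longrightarrow> h -` A \<inter> space M \<in> ?E i\<close>[OF that] \<open>i \<in> C\<close> in blast)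
  qed
  have X': "X \<in> sigma (space M) (\<Union>i\<in>C. ?E i) \<rightarrow>\<^sub>M ?G" if "0 \<in> C" "C \<subseteq> {..<4}" for C
    by (rule mE[OF _ _ that]) (use measurable_space[OF mX] E0 in auto)
  have Y': "Y \<in> sigma (space M) (\<Union>i\<in>C. ?E i) \<rightarrow>\<^sub>M ?B" if "1 \<in> C" "C \<subseteq> {..<4}" for C
    by (rule mE[OF _ _ that]) (use measurable_space[OF mY] E1 in auto)
  have Z': "Z \<in> sigma (space M) (\<Union>i\<in>C. ?E i) \<rightarrow>\<^sub>M ?U" if "2 \<in> C" "C \<subseteq> {..<4}" for C
    by (rule mE[OF _ _ that]) (use measurable_space[OF mZ] E2 in auto)
  have F': "(\<lambda>\<omega>. \<omega>) \<in> sigma (space M) (\<Union>i\<in>C. ?E i) \<rightarrow>\<^sub>M F" if "3 \<in> C" "C \<subseteq> {..<4}" for C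
    by (rule mE[OF _ _ that]) (use F sets.sets_into_space[of _ F] E3 in \<open>auto simp: Int_absorb2\<close>)
  have yz: "distr M ?B Y \<Otimes>\<^sub>M distr M ?U Z = distr M (?B \<Otimes>\<^sub>M ?U) (\<lambda>\<omega>. (Y \<omega>, Z \<omega>))"
    by (rule distr_Pair_if_indep_sets[OF sequences_indep _ _ st Y' Z', of "{1}" "{2}"]) auto
  have xyz: "distr M ?G X \<Otimes>\<^sub>M distr M (?B \<Otimes>\<^sub>M ?U) (\<lambda>\<omega>. (Y \<omega>, Z \<omega>))
      = distr M (?G \<Otimes>\<^sub>M (?B \<Otimes>\<^sub>M ?U)) (\<lambda>\<omega>. (X \<omega>, Y \<omega>, Z \<omega>))"
    by (rule distr_Pair_if_indep_sets[OF sequences_indep _ _ st X' measurable_Pair[OF Y' Z'], of "{0}" "{1, 2}"]) auto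
  have all: "distr M F (\<lambda>\<omega>. \<omega>) \<Otimes>\<^sub>M distr M (?G \<Otimes>\<^sub>M (?B \<Otimes>\<^sub>M ?U)) (\<lambda>\<omega>. (X \<omega>, Y \<omega>, Z \<omega>))
      = distr M (F \<Otimes>\<^sub>M (?G \<Otimes>\<^sub>M (?B \<Otimes>\<^sub>M ?U))) (\<lambda>\<omega>. (\<omega>, X \<omega>, Y \<omega>, Z \<omega>))"
    by (rule distr_Pair_if_indep_sets[OF sequences_indep _ _ st F' measurable_Pair[OF X' measurable_Pair[OF Y' Z']],
          of "{3}" "{0, 1, 2}"]) auto
  have lX: "distr M ?G X = PiM {1..} (\<lambda>_. \<mu>)"
  proof -
    have "distr M ?G X = PiM {1..} (\<lambda>i. distr M borel (g i))"
      using g_indep unfolding X_def by (subst (asm) indep_vars_iff_distr_eq_PiM') (auto simp: measurable_drivers)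
    also have "\<dots> = PiM {1..} (\<lambda>_. \<mu>)"
      by (intro PiM_cong refl g_distr) auto
    finally show ?thesis .
  qed
  have lY: "distr M ?B Y = xi_space \<alpha>"
  proof -
    have "distr M ?B Y = PiM {2..} (\<lambda>i. distr M (count_space UNIV) (\<xi> i))"
      using xi_indep unfolding Y_def by (subst (asm) indep_vars_iff_distr_eq_PiM') (auto simp: measurable_drivers)
    also have "\<dots> = xi_space \<alpha>"
      unfolding xi_space_def by (intro PiM_cong refl xi_distr) auto
    finally show ?thesis .
  qed
  have lZ: "distr M ?U Z = u_space"
  proof -
    have "distr M ?U Z = PiM {2..} (\<lambda>i. distr M (count_space {1..i-1}) (u i))"
      using u_indep measurable_drivers(3) unfolding Z_def by (subst (asm) indep_vars_iff_distr_eq_PiM') auto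
    also have "\<dots> = u_space"
      unfolding u_space_def by (intro PiM_cong refl u_distr) auto
    finally show ?thesis .
  qed
  have law: "distr M (?G \<Otimes>\<^sub>M (?B \<Otimes>\<^sub>M ?U)) (\<lambda>\<omega>. (X \<omega>, Y \<omega>, Z \<omega>)) = canonical_measure \<mu> \<alpha>"
    unfolding xyz[symmetric] yz[symmetric] lX lY lZ canonical_measure_def ..
  have sets: "sets (?G \<Otimes>\<^sub>M (?B \<Otimes>\<^sub>M ?U)) = sets (canonical_measure \<mu> \<alpha>)"
    unfolding law[symmetric] by simp
  have d: "driver = (\<lambda>\<omega>. (X \<omega>, Y \<omega>, Z \<omega>))"
    by (simp add: fun_eq_iff driver_def X_def Y_def Z_def)
  have "(\<lambda>\<omega>. (X \<omega>, Y \<omega>, Z \<omega>)) \<in> M \<rightarrow>\<^sub>M ?G \<Otimes>\<^sub>M (?B \<Otimes>\<^sub>M ?U)"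
    using mX mY mZ by measurable
  then show "driver \<in> M \<rightarrow>\<^sub>M canonical_measure \<mu> \<alpha>"
    unfolding d measurable_cong_sets[OF refl sets] .
  show "distr M (F \<Otimes>\<^sub>M canonical_measure \<mu> \<alpha>) (\<lambda>\<omega>. (\<omega>, driver \<omega>)) = distr M F (\<lambda>\<omega>. \<omega>) \<Otimes>\<^sub>M canonical_measure \<mu> \<alpha>"
    using all unfolding law d by (subst (asm) distr_cong[OF refl sets_pair_measure_cong[OF refl sets] refl]) simp
qed

lemma measurable_srrw: "srrw g \<xi> u T n \<in> M \<rightarrow>\<^sub>M borel"
proof -
  have T': "(\<lambda>(\<omega>, x). T k \<omega> x) \<in> M \<Otimes>\<^sub>M borel \<rightarrow>\<^sub>M borel" if "2 \<le> k" for k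
  proof -
    have "(\<lambda>p. p) \<in> M \<Otimes>\<^sub>M borel \<rightarrow>\<^sub>M F \<Otimes>\<^sub>M (borel :: 'a measure)"
      using measurable_Pair[OF measurable_compose[OF measurable_fst measurable_id_F] measurable_snd] by simp
    from measurable_compose[OF this T_measurable[OF that]] show ?thesis .
  qed
  have "srrw_step g \<xi> u T k \<in> M \<rightarrow>\<^sub>M borel" if "1 \<le> k" for k
    by (rule measurable_srrw_step[OF _ _ _ T' that]) (auto intro: measurable_drivers(1,2) measurable_drivers(3)[simplified])
  then show ?thesis
    unfolding srrw_def by (intro borel_measurable_sum) auto
qed

lemma srrw_eq_canonical_walk:
  assumes "\<omega> \<in> space M"
  shows "srrw g \<xi> u T n \<omega> = canonical_walk (\<lambda>k. T k \<omega>) n (driver \<omega>)"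
  unfolding srrw_def canonical_walk_def
proof (intro sum.cong refl srrw_step_cong)
  show "u k \<omega> \<in> {1..k-1}" if "2 \<le> k" for k
    using measurable_space[OF measurable_drivers(3)[OF that] assms] by simp
qed (auto simp: driver_def)

text \<open>The law of the walk is a mixture of laws of walks with fixed transformations: by the product law above,
Fubini's theorem integrates out the driving paths first, for fixed \<open>\<omega>\<close> and thus for fixed \<open>T k \<omega>\<close>. A
bound that is uniform in the transformations survives with the same constant.\<close>
lemma prob_srrw_le:
  assumes A: "A \<in> sets borel" and b: "0 \<le> b"
    and bound: "\<And>t. (\<And>k. 2 \<le> k \<Longrightarrow> t k \<in> borel \<rightarrow>\<^sub>M borel) \<Longrightarrow>
      measure (canonical_measure \<mu> \<alpha>) {p \<in> space (canonical_measure \<mu> \<alpha>). canonical_walk t n p \<in> A} \<le> b"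
  shows "prob {\<omega> \<in> space M. srrw g \<xi> u T n \<omega> \<in> A} \<le> b"
proof -
  let ?N = "canonical_measure \<mu> \<alpha>"
  let ?M = "distr M F (\<lambda>\<omega>. \<omega>)"
  interpret N: prob_space ?N by (rule prob_space_canonical_measure[OF prob_space_mu])
  interpret MF: prob_space ?M by (rule prob_space_distr[OF measurable_id_F])
  define W where "W q = canonical_walk (\<lambda>k. T k (fst q)) n (snd q)" for q
  have W: "W \<in> F \<Otimes>\<^sub>M ?N \<rightarrow>\<^sub>M borel"
  proof -
    have sN: "sets ?N = sets (PiM {1..} (\<lambda>_. borel) \<Otimes>\<^sub>M (PiM {2..} (\<lambda>_. count_space UNIV) \<Otimes>\<^sub>M PiM {2..} (\<lambda>n. count_space {1..n-1})))"
      unfolding canonical_measure_def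
      by (intro sets_pair_measure_cong sets_xi_space sets_u_space sets_PiM_cong refl sets_mu)
    let ?P = "F \<Otimes>\<^sub>M ?N"
    have m1: "(\<lambda>q. fst (snd q) k) \<in> ?P \<rightarrow>\<^sub>M borel" if "1 \<le> k" for k
      unfolding measurable_cong_sets[OF sets_pair_measure_cong[OF refl sN] refl]
      by (rule measurable_compose[OF measurable_snd measurable_compose[OF measurable_fst measurable_component_singleton]]) (use that in simp)
    have m2: "(\<lambda>q. fst (snd (snd q)) k) \<in> ?P \<rightarrow>\<^sub>M count_space UNIV" if "2 \<le> k" for k
      unfolding measurable_cong_sets[OF sets_pair_measure_cong[OF refl sN] refl]
      by (rule measurable_compose[OF measurable_snd measurable_compose[OF measurable_snd
            measurable_compose[OF measurable_fst measurable_component_singleton]]]) (use that in simp)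
    have m3: "(\<lambda>q. snd (snd (snd q)) k) \<in> ?P \<rightarrow>\<^sub>M count_space {1..k-1}" if "2 \<le> k" for k
      unfolding measurable_cong_sets[OF sets_pair_measure_cong[OF refl sN] refl]
      by (rule measurable_compose[OF measurable_snd measurable_compose[OF measurable_snd
            measurable_compose[OF measurable_snd measurable_component_singleton]]]) (use that in simp)
    have m4: "(\<lambda>(q, x). T k (fst q) x) \<in> ?P \<Otimes>\<^sub>M borel \<rightarrow>\<^sub>M borel" if "2 \<le> k" for k
    proof -
      have "(\<lambda>q. (fst (fst q), snd q)) \<in> ?P \<Otimes>\<^sub>M borel \<rightarrow>\<^sub>M F \<Otimes>\<^sub>M borel" by measurable
      from measurable_compose[OF this T_measurable[OF that]] show ?thesis by (simp add: case_prod_unfold)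
    qed
    let ?w = "srrw (\<lambda>k q. fst (snd q) k) (\<lambda>k q. fst (snd (snd q)) k) (\<lambda>k q. snd (snd (snd q)) k) (\<lambda>k q. T k (fst q)) n"
    have "?w \<in> ?P \<rightarrow>\<^sub>M borel"
      unfolding srrw_def using measurable_srrw_step[OF m1 m2 m3 m4]
      by (intro borel_measurable_sum) auto
    moreover have "?w q = W q" if "q \<in> space ?P" for q
      unfolding W_def canonical_walk_def srrw_def
    proof (intro sum.cong refl srrw_step_cong)
      show "snd (snd (snd q)) k \<in> {1..k-1}" if "2 \<le> k" for k
        using measurable_space[OF m3[OF that] \<open>q \<in> space ?P\<close>] by simp
    qed auto
    ultimately show ?thesis by (simp cong: measurable_cong)
  qed
  let ?D = "\<lambda>\<omega>. (\<omega>, driver \<omega>)"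
  have D: "?D \<in> M \<rightarrow>\<^sub>M F \<Otimes>\<^sub>M ?N" using measurable_id_F measurable_driver by measurable
  define Q where "Q = W -` A \<inter> space (F \<Otimes>\<^sub>M ?N)"
  have Q: "Q \<in> sets (F \<Otimes>\<^sub>M ?N)" unfolding Q_def using W A by (rule measurable_sets)
  have "{\<omega> \<in> space M. srrw g \<xi> u T n \<omega> \<in> A} = ?D -` Q \<inter> space M"
    using measurable_space[OF D] by (auto simp: Q_def W_def srrw_eq_canonical_walk)
  then have "emeasure M {\<omega> \<in> space M. srrw g \<xi> u T n \<omega> \<in> A} = emeasure (distr M (F \<Otimes>\<^sub>M ?N) ?D) Q"
    using Q D by (simp add: emeasure_distr)
  also have "\<dots> = emeasure (?M \<Otimes>\<^sub>M ?N) Q" by (simp only: distr_driver)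
  also have "\<dots> = (\<integral>\<^sup>+\<omega>. emeasure ?N (Pair \<omega> -` Q) \<partial>?M)"
    using Q by (intro N.emeasure_pair_measure_alt) (simp cong: sets_pair_measure_cong)
  also have "\<dots> \<le> (\<integral>\<^sup>+\<omega>. ennreal b \<partial>?M)"
  proof (rule nn_integral_mono)
    fix \<omega> assume "\<omega> \<in> space ?M"
    then have \<omega>: "\<omega> \<in> space F" by simp
    have "T k \<omega> \<in> borel \<rightarrow>\<^sub>M borel" if "2 \<le> k" for k
      using measurable_compose[OF measurable_Pair1'[OF \<omega>] T_measurable[OF that]] by simp
    from bound[OF this] have "measure ?N {p \<in> space ?N. canonical_walk (\<lambda>k. T k \<omega>) n p \<in> A} \<le> b" .
    moreover have "Pair \<omega> -` Q = {p \<in> space ?N. canonical_walk (\<lambda>k. T k \<omega>) n p \<in> A}"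
      using \<omega> by (auto simp: Q_def W_def space_pair_measure)
    ultimately show "emeasure ?N (Pair \<omega> -` Q) \<le> ennreal b"
      by (simp add: N.emeasure_eq_measure ennreal_leI)
  qed
  also have "\<dots> = ennreal b" using MF.emeasure_space_1 by simp
  finally show ?thesis using b by (simp add: emeasure_eq_measure)
qed

end

section \<open>Concentration and transience\<close>

text \<open>Fixed transformations are the worst case, so a bound for them serves all walks with the same constant.\<close>
lemma srrw_concentrationI:
  fixes \<mu> :: "'a::euclidean_space measure"
  assumes "C > 0" and bound: "\<And>t n z. \<lbrakk>\<And>k. 2 \<le> k \<Longrightarrow> t k \<in> borel \<rightarrow>\<^sub>M borel; 1 \<le> n\<rbrakk> \<Longrightarrow>
       measure (canonical_measure \<mu> \<alpha>) {p \<in> space (canonical_measure \<mu> \<alpha>). canonical_walk t n p \<in> ball z r}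
         \<le> C * real n powr (- (real DIM('a) / 2))"
  shows "srrw_concentration TYPE('w) \<mu> \<alpha> r C"
  unfolding srrw_concentration_def
proof (intro allI impI)
  fix M :: "'w measure" and F g \<xi> u T and n :: nat
  assume "generalized_srrw M \<mu> \<alpha> F g \<xi> u T" and n: "1 \<le> n"
  then interpret generalized_srrw M \<mu> \<alpha> F g \<xi> u T by simp
  show "(SUP x. measure M {\<omega> \<in> space M. srrw g \<xi> u T n \<omega> \<in> ball x r}) \<le> C * real n powr (- (real DIM('a) / 2))"
    using \<open>C > 0\<close> bound n by (intro cSUP_least prob_srrw_le) auto
qed

lemma srrw_concentrationD:
  fixes M :: "'w measure" and \<mu> :: "'a::euclidean_space measure"
  assumes "srrw_concentration TYPE('w) \<mu> \<alpha> r C" "generalized_srrw M \<mu> \<alpha> F g \<xi> u T" "1 \<le> n"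
  shows "measure M {\<omega> \<in> space M. srrw g \<xi> u T n \<omega> \<in> ball z r} \<le> C * real n powr (- (real DIM('a) / 2))"
proof -
  interpret generalized_srrw M \<mu> \<alpha> F g \<xi> u T by fact
  have "measure M {\<omega> \<in> space M. srrw g \<xi> u T n \<omega> \<in> ball z r}
      \<le> (SUP x. measure M {\<omega> \<in> space M. srrw g \<xi> u T n \<omega> \<in> ball x r})"
    by (intro cSUP_upper bdd_aboveI[of _ 1]) auto
  also have "\<dots> \<le> C * real n powr (- (real DIM('a) / 2))"
    using assms unfolding srrw_concentration_def by blast
  finally show ?thesis .
qed

text \<open>The bound \<open>C n powr (- d / 2)\<close> is summable for \<open>d \<ge> 3\<close>, and the lemma of Borel and Cantelli applies to the
visits to each ball around the origin.\<close>
lemma (in generalized_srrw) transient_if_concentration: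
  assumes dim: "DIM('a) \<ge> 3" and conc: "\<And>r. r > 0 \<Longrightarrow> \<exists>C. srrw_concentration TYPE('w) \<mu> \<alpha> r C"
  shows "transient M (srrw g \<xi> u T)"
proof -
  let ?S = "srrw g \<xi> u T"
  have "AE \<omega> in M. \<forall>\<^sub>F n in sequentially. real R \<le> norm (?S n \<omega>)" for R
  proof -
    define r where "r = real (Suc R)"
    have r: "r > 0" by (simp add: r_def)
    from conc[OF r] obtain C where C: "srrw_concentration TYPE('w) \<mu> \<alpha> r C" by blast
    let ?A = "\<lambda>n. {\<omega> \<in> space M. ?S n \<omega> \<in> ball 0 r}"
    have A: "?A n \<in> events" for n
      using measurable_sets[OF measurable_srrw, of "ball 0 r" n] by (simp add: vimage_def Int_def conj_commute)
    have "summable (\<lambda>n. prob (?A n))"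
    proof (rule summable_comparison_test'[where N = 1])
      show "summable (\<lambda>n. C * real n powr (- (real DIM('a) / 2)))"
        using dim by (intro summable_mult) (simp add: summable_real_powr_iff)
      show "norm (prob (?A n)) \<le> C * real n powr (- (real DIM('a) / 2))" if "n \<ge> 1" for n
        using srrw_concentrationD[OF C generalized_srrw_axioms that, of 0] by simp
    qed
    then have "AE \<omega> in M. \<forall>\<^sub>F n in sequentially. \<omega> \<in> space M - ?A n"
      using A by (intro borel_cantelli_AE1) (auto simp: emeasure_eq_measure)
    then show ?thesis
      by eventually_elim (auto elim!: eventually_mono simp: r_def)
  qed
  then have "AE \<omega> in M. \<forall>R. \<forall>\<^sub>F n in sequentially. real R \<le> norm (?S n \<omega>)"
    by (simp add: AE_all_countable)
  then show ?thesis
    unfolding transient_def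
  proof eventually_elim
    case (elim \<omega>)
    show "filterlim (\<lambda>n. norm (?S n \<omega>)) at_top sequentially"
      unfolding filterlim_at_top
    proof
      fix Z :: real
      obtain R :: nat where "Z \<le> real R" using real_arch_simple by blast
      then show "\<forall>\<^sub>F n in sequentially. Z \<le> norm (?S n \<omega>)"
        using elim[rule_format, of R] by (auto elim!: eventually_mono)
    qed
  qed
qed

theorem proposition1p1:
  fixes \<mu> :: "'a::euclidean_space measure" and \<alpha> :: real
  assumes "prob_space \<mu>" and "sets \<mu> = sets borel" and "nonsingular \<mu>"
    and "0 \<le> \<alpha>" and "\<alpha> < 1"
  shows "(\<forall>r>0. (\<exists>C>0. srrw_concentration TYPE('a canonical_space) \<mu> \<alpha> r C) \<and>
           (\<forall>C>0. srrw_concentration TYPE('a canonical_space) \<mu> \<alpha> r C \<longrightarrow>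
                  srrw_concentration TYPE('w) \<mu> \<alpha> r C)) \<and>
         (DIM('a) \<ge> 3 \<longrightarrow>
           (\<forall>(M :: 'w measure) F g \<xi> u T.
             generalized_srrw M \<mu> \<alpha> F g \<xi> u T \<longrightarrow> transient M (srrw g \<xi> u T)))"
proof (intro conjI allI impI)
  fix r :: real assume "r > 0"
  from canonical_walk_concentration[OF assms this] obtain C where C: "C > 0"
    "\<And>t n z. \<lbrakk>\<And>k. 2 \<le> k \<Longrightarrow> t k \<in> borel \<rightarrow>\<^sub>M borel; 1 \<le> n\<rbrakk> \<Longrightarrow>
       measure (canonical_measure \<mu> \<alpha>) {p \<in> space (canonical_measure \<mu> \<alpha>). canonical_walk t n p \<in> ball z r}
         \<le> C * real n powr (- (real DIM('a) / 2))" by blast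
  from C(1) srrw_concentrationI[OF C]
  show "\<exists>C>0. srrw_concentration TYPE('a canonical_space) \<mu> \<alpha> r C" by blast
next
  fix r C :: real
  assume C: "C > 0" "srrw_concentration TYPE('a canonical_space) \<mu> \<alpha> r C"
  show "srrw_concentration TYPE('w) \<mu> \<alpha> r C"
  proof (rule srrw_concentrationI[OF C(1)])
    \<comment> \<open>The canonical space carries each walk with fixed transformations, so the assumption covers the worst case.\<close>
    fix t :: "nat \<Rightarrow> 'a \<Rightarrow> 'a" and n :: nat and z
    assume "\<And>k. 2 \<le> k \<Longrightarrow> t k \<in> borel \<rightarrow>\<^sub>M borel" and n: "1 \<le> n"
    then have "generalized_srrw (canonical_measure \<mu> \<alpha>) \<mu> \<alpha> (sigma (space (canonical_measure \<mu> \<alpha>)) {})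
        (\<lambda>k p. fst p k) (\<lambda>k p. fst (snd p) k) (\<lambda>k p. snd (snd p) k) (\<lambda>k _. t k)"
      using assms by (intro generalized_srrw_canonical) auto
    from srrw_concentrationD[OF C(2) this n, of z]
    show "measure (canonical_measure \<mu> \<alpha>) {p \<in> space (canonical_measure \<mu> \<alpha>). canonical_walk t n p \<in> ball z r}
         \<le> C * real n powr (- (real DIM('a) / 2))"
      by (simp only: canonical_walk_def)
  qed
next
  fix M :: "'w measure" and F g \<xi> u T
  assume dim: "3 \<le> DIM('a)" and "generalized_srrw M \<mu> \<alpha> F g \<xi> u T"
  then interpret generalized_srrw M \<mu> \<alpha> F g \<xi> u T by simp
  show "transient M (srrw g \<xi> u T)"
  proof (rule transient_if_concentration[OF dim])
    fix r :: real assume "r > 0"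
    from canonical_walk_concentration[OF assms this] obtain C where C: "C > 0"
      "\<And>t n z. \<lbrakk>\<And>k. 2 \<le> k \<Longrightarrow> t k \<in> borel \<rightarrow>\<^sub>M borel; 1 \<le> n\<rbrakk> \<Longrightarrow>
       measure (canonical_measure \<mu> \<alpha>) {p \<in> space (canonical_measure \<mu> \<alpha>). canonical_walk t n p \<in> ball z r}
         \<le> C * real n powr (- (real DIM('a) / 2))" by blast
    from srrw_concentrationI[OF C] show "\<exists>C. srrw_concentration TYPE('w) \<mu> \<alpha> r C" by blast
  qed
qed

end
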